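(* Let $q$ be a prime power, $n$ and $k$ positive integers, and let $\mathcal{V}$ be an intersecting $k$-Sperner family of subspaces of $\mathbb{F}_{q}^{n}$ such that $\dim(V) \leq \lfloor n/2 \rfloor$ for every $V \in \mathcal{V}$. Then \[|\mathcal{V}| \leq \sum_{j = \lfloor n/2 \rfloor - k + 1}^{\lfloor n/2 \rfloor}\genfrac{[}{]}{0pt}{}{n-1}{j-1},\] and equality holds if and only if there exists a $1$-dimensional subspace $R$ of $\mathbb{F}_{q}^{n}$ such that $\mathcal{V}_{j} := \{V \in \mathcal{V} : \dim(V) = j\}$ equals $\mathcal{L}_{n,j}[R]$ for each $\lfloor n/2 \rfloor - k + 1 \leq j \leq \lfloor n/2 \rfloor$.
   Context: $\mathbb{F}_q$ is the finite field with $q$ elements. The Gaussian coefficient is $\genfrac{[}{]}{0pt}{}{n}{k} = \prod_{0 \leq i \leq k-1}\frac{q^{n-i}-1}{q^{k-i}-1}$; it counts the $k$-dimensional subspaces of $\mathbb{F}_q^n$. A family $\mathcal{V}$ of subspaces is intersecting if $\dim(V \cap W) > 0$ for every pair of distinct $V, W \in \mathcal{V}$. A family is $k$-Sperner if every chain (totally ordered by inclusion subfamily) in it has at most $k$ members. $\mathcal{L}_{n,j}[R]$ denotes the set of all $j$-dimensional subspaces of $\mathbb{F}_q^n$ containing the subspace $R$.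
   Formalization: For n ≤ 3 the family {{0}} is excluded (it violates the bound or the equality claim); for k = 1 and even n ≥ 4 only the "if" half of the equality claim is asserted, since all n/2-dimensional subspaces of a hyperplane also attain the bound. *)

theory Defs
  imports "HOL-Analysis.Cartesian_Space"
begin

text \<open>The lower index is an integer because the sums it is used in may run over non-positive
  indices. For a negative lower index the value is \<open>0\<close>, in accordance with counting subspaces;
  the bare (empty) product would be \<open>1\<close>. The truncated subtraction is harmless:
  if \<open>k > n\<close>, the factor with \<open>i = n\<close> vanishes.\<close>

definition gaussian_coefficient :: "nat \<Rightarrow> nat \<Rightarrow> int \<Rightarrow> real" where
  "gaussian_coefficient q n k =
     (if k < 0 then 0
      else (\<Prod>i<nat k. (real q ^ (n - i) - 1) / (real q ^ (nat k - i) - 1)))"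

definition intersecting_family :: "(('a::field) ^ 'n::finite) set set \<Rightarrow> bool" where
  "intersecting_family \<V> \<longleftrightarrow> pairwise (\<lambda>V W. vec.dim (V \<inter> W) > 0) \<V>"

definition Sperner_family :: "nat \<Rightarrow> 'b set set \<Rightarrow> bool" where
  "Sperner_family k \<V> \<longleftrightarrow> (\<forall>C. subset.chain \<V> C \<longrightarrow> finite C \<and> card C \<le> k)"

definition subspaces_containing ::
    "int \<Rightarrow> (('a::field) ^ 'n::finite) set \<Rightarrow> ('a ^ 'n) set set" where
  "subspaces_containing j R = {V. vec.subspace V \<and> int (vec.dim V) = j \<and> R \<subseteq> V}"

definition dim_level ::
    "(('a::field) ^ 'n::finite) set set \<Rightarrow> int \<Rightarrow> ('a ^ 'n) set set" where
  "dim_level \<V> j = {V \<in> \<V>. int (vec.dim V) = j}"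

end

theory Submission
  imports Defs "HOL-Algebra.Algebraic_Closure_Type"
begin

text \<open>
  Write \<open>c\<^sub>i\<close> for the number of \<open>i\<close>-dimensional subspaces through a fixed line. The key fact is that a
  family \<open>F\<close> of at most \<open>c\<^sub>i\<close> subspaces of dimension \<open>i\<close> has an upper shadow of size at least
  \<open>|F| c\<^sub>i\<^sub>+\<^sub>1 / c\<^sub>i\<close>, and that for \<open>|F| = c\<^sub>i\<close> equality forces a star. It is a dual, linear form of Keevash's
  proof of the Lovasz version of the Kruskal-Katona theorem: one bounds the number of \<open>s\<close>-dimensional
  subspaces all of whose \<open>(s+1)\<close>-dimensional superspaces lie in a given family \<open>G\<close>, locally at every
  hyperplane \<open>H\<close>, either by counting the members of \<open>G\<close> outside \<open>H\<close> or by induction inside \<open>H\<close>.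

  The Erdos-Ko-Rado theorem at level \<open>m\<close> in dimension \<open>2m\<close> follows by averaging over the images of a spread.
  Dimension \<open>2m+1\<close> is embedded as a hyperplane in dimension \<open>2m+2\<close>, where the upper shadow is again
  intersecting and counts the members of \<open>F\<close> with weight \<open>q\<^sup>m\<^sup>+\<^sup>1\<close>; Pascal's rule and the shadow
  inequality then give the bound and its equality case. Lower levels are pushed up with the shadow inequality.

  Pushing an intersecting antichain up level by level gives the LYM type inequality
  \<open>\<Sum>|F\<^sub>i| / c\<^sub>i \<le> 1\<close>. Peeling off minimal elements yields \<open>\<Sum>|V\<^sub>i| / c\<^sub>i \<le> k\<close> for a \<open>k\<close>-Sperner family, and since
  \<open>|V\<^sub>i| \<le> c\<^sub>i\<close> and \<open>c\<^sub>i\<close> increases up to \<open>\<lfloor>n/2\<rfloor>\<close>, the total is largest when exactly the top \<open>k\<close> levels are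
  full. One such level below \<open>n/2\<close> is a star by the equality case, and it forces its centre on all others.
\<close>

section \<open>Gaussian coefficients and counting subspaces\<close>

text \<open>The q-analogue \<open>(q^k - 1)/(q - 1)\<close> of \<open>k\<close>, written without
  division so that it is a natural number. It counts the lines through the origin of a
  \<open>k\<close>-dimensional space and, dually, its hyperplanes.\<close>

definition qint :: "nat \<Rightarrow> nat \<Rightarrow> nat" where
  "qint q k = (\<Sum>i<k. q ^ i)"

lemma qint_simps [simp]: "qint q 0 = 0" "qint q (Suc k) = qint q k + q ^ k"
  by (simp_all add: qint_def)

lemma qint_mult: "real (qint q k) * (real q - 1) = real q ^ k - 1"
  by (induction k) (simp_all add: algebra_simps)

lemma qint_shift: "qint q (Suc k) = 1 + q * qint q k"
  unfolding qint_def by (subst sum.lessThan_Suc_shift) (simp add: sum_distrib_left)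

text \<open>The q-factorial of \<open>k\<close> times \<open>(q - 1)^k\<close>; the extra factors
  cancel in every Gaussian coefficient.\<close>

definition qfact :: "nat \<Rightarrow> nat \<Rightarrow> real" where
  "qfact q k = (\<Prod>i<k. real q ^ Suc i - 1)"

lemma qfact_Suc [simp]: "qfact q (Suc k) = qfact q k * (real q ^ Suc k - 1)"
  by (simp add: qfact_def)

lemma qfact_0 [simp]: "qfact q 0 = 1"
  by (simp add: qfact_def)

lemma q_power_gt_1: "q \<ge> 2 \<Longrightarrow> k > 0 \<Longrightarrow> real q ^ k > 1"
  by (simp add: one_less_power)

lemma qfact_pos: "q \<ge> 2 \<Longrightarrow> qfact q k > 0"
  by (induction k) (use q_power_gt_1[of q "Suc _"] in \<open>simp_all del: power_Suc\<close>)

definition gauss :: "nat \<Rightarrow> nat \<Rightarrow> nat \<Rightarrow> real" where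
  "gauss q n k = gaussian_coefficient q n (int k)"

lemma gauss_eq_qfact:
  assumes q: "q \<ge> 2" and k: "k \<le> n"
  shows "gauss q n k = qfact q n / (qfact q k * qfact q (n - k))"
proof -
  have num: "(\<Prod>i<k. real q ^ (n - i) - 1) * qfact q (n - k) = qfact q n"
    using k
  proof (induction k)
    case (Suc k)
    have "n - k = Suc (n - Suc k)" using Suc.prems by simp
    then have "qfact q (n - k) = (real q ^ (n - k) - 1) * qfact q (n - Suc k)"
      by simp
    then show ?case using Suc by (simp add: mult_ac)
  qed simp
  have den: "(\<Prod>i<k. real q ^ (k - i) - 1) = qfact q k"
    unfolding qfact_def
    by (subst prod.nat_diff_reindex[symmetric]) (auto intro!: prod.cong simp: Suc_diff_Suc simp del: power_Suc)
  show ?thesis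
    unfolding num[symmetric] den[symmetric] using qfact_pos[OF q, of "n - k"]
    by (simp add: gauss_def gaussian_coefficient_def prod_dividef)
qed

lemma gauss_0 [simp]: "gauss q n 0 = 1"
  by (simp add: gauss_def gaussian_coefficient_def)

lemma gauss_pos: "q \<ge> 2 \<Longrightarrow> k \<le> n \<Longrightarrow> gauss q n k > 0"
  by (simp add: gauss_eq_qfact qfact_pos)

lemma gauss_symmetric: "q \<ge> 2 \<Longrightarrow> k \<le> n \<Longrightarrow> gauss q n (n - k) = gauss q n k"
  by (subst (1 2) gauss_eq_qfact) (simp_all add: mult_ac)

lemma gauss_Suc_right:
  assumes q: "q \<ge> 2" and k: "k < n"
  shows "gauss q n (Suc k) * (real q ^ Suc k - 1) = gauss q n k * (real q ^ (n - k) - 1)"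
proof -
  define d where "d = real q ^ Suc k - 1"
  define e where "e = real q ^ (n - k) - 1"
  have "d > 0" "e > 0"
    using q_power_gt_1[OF q, of "Suc k"] q_power_gt_1[OF q, of "n - k"] k by (simp_all add: d_def e_def)
  have "n - k = Suc (n - Suc k)" using k by simp
  then have "qfact q (n - k) = e * qfact q (n - Suc k)"
    by (simp add: e_def)
  moreover have "qfact q (Suc k) = qfact q k * d" by (simp add: d_def)
  ultimately show ?thesis
    unfolding d_def[symmetric] e_def[symmetric] using q k \<open>d > 0\<close> \<open>e > 0\<close>
    by (simp add: gauss_eq_qfact del: power_Suc qfact_Suc)
qed

lemma gauss_Suc_Suc:
  assumes q: "q \<ge> 2" and k: "k \<le> n"
  shows "gauss q (Suc n) (Suc k) * (real q ^ Suc k - 1) = gauss q n k * (real q ^ Suc n - 1)"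
proof -
  define d where "d = real q ^ Suc k - 1"
  have "d > 0" using q_power_gt_1[OF q, of "Suc k"] by (simp add: d_def)
  have "gauss q (Suc n) (Suc k) = qfact q n * (real q ^ Suc n - 1) / (qfact q k * d * qfact q (n - k))"
    using q k by (simp add: gauss_eq_qfact d_def del: power_Suc)
  then show ?thesis
    unfolding d_def[symmetric] using q k \<open>d > 0\<close>
    by (simp add: gauss_eq_qfact del: power_Suc qfact_Suc)
qed

lemma gauss_pascal:
  assumes q: "q \<ge> 2" and k: "k < n"
  shows "gauss q (Suc n) (Suc k) = gauss q n (Suc k) + real q ^ (n - k) * gauss q n k"
proof -
  define d where "d = real q ^ Suc k - 1"
  have "d > 0" using q_power_gt_1[OF q, of "Suc k"] by (simp add: d_def)
  have e: "real q ^ (n - k) * real q ^ Suc k = real q ^ Suc n"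
    using k by (simp flip: power_add)
  have rearrange: "a * (b - 1) + b * a * (c - 1) = a * (b * c - 1)" for a b c :: real
    by (simp add: algebra_simps)
  have "(gauss q n (Suc k) + real q ^ (n - k) * gauss q n k) * d
      = gauss q n k * (real q ^ (n - k) - 1) + real q ^ (n - k) * gauss q n k * d"
    using gauss_Suc_right[OF q k] by (simp add: d_def distrib_right)
  also have "\<dots> = gauss q n k * (real q ^ (n - k) * real q ^ Suc k - 1)"
    unfolding d_def by (rule rearrange)
  also have "\<dots> = gauss q (Suc n) (Suc k) * d"
    using gauss_Suc_Suc[OF q, of k n] k unfolding e d_def by simp
  finally show ?thesis using \<open>d > 0\<close> by simp
qed

section \<open>Cardinalities of subspaces and of intervals in the subspace lattice\<close>

lemma (in vector_space) card_span_independent: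
  assumes fin: "finite (UNIV :: 'a set)" and "finite B" "independent B"
  shows "finite (span B) \<and> card (span B) = CARD('a) ^ card B"
  using assms(2,3)
proof (induction B)
  case empty
  then show ?case by (simp add: span_empty)
next
  case (insert b B)
  have b: "b \<notin> span B" and B: "independent B"
    using insert.prems insert.hyps by (auto simp: independent_insert split: if_splits)
  \<comment> \<open>The coefficient of \<open>b\<close> is unique modulo \<open>span B\<close>, so
    \<open>b\<close> contributes one factor \<open>CARD('a)\<close>. Working in the locale
    \<open>vector_space\<close> covers both \<open>'a ^ 'n\<close> and the algebraic closure over
    the ground field.\<close>
  have "bij_betw (\<lambda>(c, x). scale c b + x) (UNIV \<times> span B) (span (insert b B))"
    unfolding bij_betw_def
  proof
    show "inj_on (\<lambda>(c, x). scale c b + x) (UNIV \<times> span B)"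
    proof (clarsimp simp: inj_on_def)
      fix c x d y
      assume x: "x \<in> span B" and y: "y \<in> span B" and eq: "scale c b + x = scale d b + y"
      have "scale (c - d) b = y - x"
        using eq by (simp add: scale_left_diff_distrib algebra_simps)
      then have "scale (c - d) b \<in> span B" using x y by (simp add: span_diff)
      then have "c = d"
        using b span_scale[of "scale (c - d) b" B "inverse (c - d)"] by (cases "c = d") auto
      then show "c = d \<and> x = y" using eq by simp
    qed
    show "(\<lambda>(c, x). scale c b + x) ` (UNIV \<times> span B) = span (insert b B)"
    proof (intro subset_antisym subsetI)
      fix y assume "y \<in> span (insert b B)"
      then obtain k where k: "y - scale k b \<in> span B" by (auto simp: span_insert)
      then show "y \<in> (\<lambda>(c, x). scale c b + x) ` (UNIV \<times> span B)"
        by (intro image_eqI[of _ _ "(k, y - scale k b)"]) auto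
    next
      fix y assume "y \<in> (\<lambda>(c, x). scale c b + x) ` (UNIV \<times> span B)"
      then obtain c x where "y = scale c b + x" "x \<in> span B" by auto
      then show "y \<in> span (insert b B)"
        by (auto simp: span_insert intro!: exI[of _ c])
    qed
  qed
  note bij_betw_same_card[OF this] bij_betw_finite[OF this]
  then show ?case using insert.IH[OF B] insert.hyps fin
    by (auto simp: card_cartesian_product)
qed

lemma card_subspace:
  fixes U :: "('a::{field,finite}^'n::finite) set"
  assumes "vec.subspace U"
  shows "card U = CARD('a) ^ vec.dim U"
proof -
  obtain B where B: "B \<subseteq> U" "vec.independent B" "U \<subseteq> vec.span B" "card B = vec.dim U"
    using vec.basis_exists by metis
  then have "vec.span B = U" using assms vec.span_subspace by blast
  then show ?thesis using vec.card_span_independent[of B] B by simp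
qed

lemma card_field_ge_2: "CARD('a::{field,finite}) \<ge> 2"
  using card_mono[of UNIV "{0, 1 :: 'a}"] by simp

text \<open>An interval of the subspace lattice, cut at one dimension. \<open>S = {0}\<close> gives
  all \<open>j\<close>-dimensional subspaces of \<open>A\<close>, a line \<open>S\<close> gives the
  star with centre \<open>S\<close>, and \<open>j = Suc (vec.dim S)\<close> gives the covers of
  \<open>S\<close>.\<close>

definition between :: "('a::field^'n::finite) set \<Rightarrow> ('a^'n) set \<Rightarrow> nat \<Rightarrow> ('a^'n) set set" where
  "between S A j = {U. vec.subspace U \<and> S \<subseteq> U \<and> U \<subseteq> A \<and> vec.dim U = j}"

lemma betweenI: "vec.subspace U \<Longrightarrow> S \<subseteq> U \<Longrightarrow> U \<subseteq> A \<Longrightarrow> vec.dim U = j \<Longrightarrow> U \<in> between S A j"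
  by (simp add: between_def)

lemma betweenD:
  assumes "U \<in> between S A j"
  shows "vec.subspace U" "S \<subseteq> U" "U \<subseteq> A" "vec.dim U = j"
  using assms by (simp_all add: between_def)

lemma zero_subset_subspace: "vec.subspace U \<Longrightarrow> {0} \<subseteq> U"
  by (simp add: vec.subspace_0)

lemma dim_join:
  fixes S T :: "('a::field^'n::finite) set"
  assumes "vec.subspace S" "vec.subspace T"
  shows "vec.dim (vec.span (S \<union> T)) + vec.dim (S \<inter> T) = vec.dim S + vec.dim T"
proof -
  have "vec.span (S \<union> T) = {x + y |x y. x \<in> S \<and> y \<in> T}"
    using assms by (simp add: vec.span_Un vec.span_eq_iff[THEN iffD2])
  then show ?thesis using vec.dim_sums_Int[OF assms] by simp
qed

lemma dim_span_insert:
  fixes T :: "('a::field^'n::finite) set"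
  assumes "vec.subspace T" "x \<notin> T"
  shows "vec.dim (vec.span (insert x T)) = Suc (vec.dim T)"
  using assms by (simp add: vec.dim_insert vec.span_eq_iff[THEN iffD2])

lemma subspace_eqI:
  fixes S T :: "('a::field^'n::finite) set"
  shows "vec.subspace S \<Longrightarrow> vec.subspace T \<Longrightarrow> S \<subseteq> T \<Longrightarrow> vec.dim T \<le> vec.dim S \<Longrightarrow> S = T"
  by (rule vec.subspace_dim_equal)

lemma span_insert_between:
  fixes S T B :: "('a::field^'n::finite) set"
  assumes "vec.subspace T" "vec.subspace B" "x \<in> B" "x \<notin> T" "S \<subseteq> T" "T \<subseteq> B"
  shows "vec.span (insert x T) \<in> between S B (Suc (vec.dim T))"
proof (rule betweenI)
  show "S \<subseteq> vec.span (insert x T)"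
    using assms(5) vec.span_superset[of "insert x T"] by blast
  show "vec.span (insert x T) \<subseteq> B"
    using assms by (intro vec.span_minimal) auto
qed (use assms dim_span_insert[OF assms(1,4)] in simp_all)

lemma between_nonempty:
  fixes S B :: "('a::field^'n::finite) set"
  assumes "vec.subspace S" "vec.subspace B" "S \<subseteq> B" "vec.dim S \<le> j" "j \<le> vec.dim B"
  obtains U where "U \<in> between S B j"
proof -
  have "\<exists>U. U \<in> between S B j"
    using assms(4,5)
  proof (induction j rule: dec_induct)
    case base
    then show ?case using assms by (intro exI[of _ S] betweenI) auto
  next
    case (step j)
    then obtain T where T: "T \<in> between S B j" by auto
    note T' = betweenD[OF T]
    have "\<not> B \<subseteq> T" using vec.dim_subset[of B T] T' step.prems by auto
    then obtain x where x: "x \<in> B" "x \<notin> T" by auto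
    have "vec.span (insert x T) \<in> between S B (Suc j)"
      using span_insert_between[of T B x S] T' x assms by simp
    then show ?case by blast
  qed
  then show thesis using that by blast
qed

lemma card_double_count:
  assumes "finite Z" "finite Y"
  shows "(\<Sum>x\<in>Z. card {y\<in>Y. P x y}) = (\<Sum>y\<in>Y. card {x\<in>Z. P x y})"
  using sum_multicount_gen[OF assms, of P "\<lambda>y. card {x\<in>Z. P x y}"] by simp

text \<open>The sets \<open>T - S\<close>, for the covers \<open>T\<close> of \<open>S\<close>
  inside \<open>B\<close>, partition \<open>B - S\<close>, and each of them has
  \<open>q^(s+1) - q^s\<close> elements.\<close>

lemma card_points_above:
  fixes S B :: "('a::{field,finite}^'n::finite) set"
  assumes S: "vec.subspace S" and B: "vec.subspace B" and SB: "S \<subseteq> B"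
  shows "card (between S B (Suc (vec.dim S))) = qint CARD('a) (vec.dim B - vec.dim S)"
proof -
  let ?L = "between S B (Suc (vec.dim S))" and ?q = "CARD('a)"
  let ?s = "vec.dim S" and ?b = "vec.dim B"
  have sb: "?s \<le> ?b" using SB by (rule vec.dim_subset)
  have "B - S = (\<Union>T\<in>?L. T - S)"
  proof (intro subset_antisym subsetI)
    fix x assume x: "x \<in> B - S"
    have "vec.span (insert x S) \<in> ?L"
      using span_insert_between[of S B x S] x S B SB by simp
    then show "x \<in> (\<Union>T\<in>?L. T - S)" using x
      by (intro UN_I[of "vec.span (insert x S)"]) (auto intro: vec.span_base)
  qed (auto dest: betweenD)
  moreover have "T \<inter> T' \<subseteq> S" if T: "T \<in> ?L" "T' \<in> ?L" "T \<noteq> T'" for T T'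
  proof (rule ccontr)
    assume "\<not> T \<inter> T' \<subseteq> S"
    then obtain x where x: "x \<in> T" "x \<in> T'" "x \<notin> S" by auto
    have "vec.span (insert x S) = U" if "U \<in> ?L" "x \<in> U" for U
      using betweenD[OF that(1)] that(2) dim_span_insert[OF S x(3)]
      by (intro subspace_eqI vec.span_minimal) simp_all
    then show False using x T by metis
  qed
  ultimately have "card (B - S) = (\<Sum>T\<in>?L. card (T - S))"
    by (simp only:, subst card_UN_disjoint) (simp, simp, blast, rule refl)
  also have "\<dots> = (\<Sum>T\<in>?L. ?q ^ Suc ?s - ?q ^ ?s)"
    by (intro sum.cong) (auto simp: between_def card_Diff_subset card_subspace[OF S] card_subspace)
  finally have "?q ^ ?b - ?q ^ ?s = card ?L * (?q ^ Suc ?s - ?q ^ ?s)"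
    using S B SB by (simp add: card_Diff_subset card_subspace)
  then have "real (?q ^ ?b - ?q ^ ?s) = real (card ?L * (?q ^ Suc ?s - ?q ^ ?s))"
    by simp
  then have "real ?q ^ ?b - real ?q ^ ?s = card ?L * (real ?q ^ Suc ?s - real ?q ^ ?s)"
    using sb card_field_ge_2[where 'a='a] by (simp add: of_nat_diff power_increasing del: power_Suc)
  moreover have "real ?q ^ ?b = real ?q ^ ?s * real ?q ^ (?b - ?s)"
    using sb by (simp flip: power_add)
  ultimately have "real ?q ^ ?s * (real ?q ^ (?b - ?s) - 1) = real ?q ^ ?s * (card ?L * (real ?q - 1))"
    by (simp add: algebra_simps)
  then have "card ?L * (real ?q - 1) = qint ?q (?b - ?s) * (real ?q - 1)"
    using card_field_ge_2[where 'a='a] by (simp add: qint_mult)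
  then show ?thesis using card_field_ge_2[where 'a='a] by simp
qed

lemma hyperplane_Int:
  fixes A H T :: "('a::field^'n::finite) set"
  assumes A: "vec.subspace A" and H: "vec.subspace H" "H \<subseteq> A" "vec.dim A = Suc (vec.dim H)"
    and T: "vec.subspace T" "T \<subseteq> A" "\<not> T \<subseteq> H"
  shows "vec.dim T = Suc (vec.dim (T \<inter> H))" and "vec.span (T \<union> H) = A"
proof -
  have sub: "vec.span (T \<union> H) \<subseteq> A" using A H T by (intro vec.span_minimal) auto
  have "\<not> vec.dim (vec.span (T \<union> H)) \<le> vec.dim H"
  proof
    assume "vec.dim (vec.span (T \<union> H)) \<le> vec.dim H"
    then have "H = vec.span (T \<union> H)"
      using H by (intro subspace_eqI) (auto intro: vec.span_base)
    then have "T \<subseteq> H" by (metis Un_subset_iff vec.span_superset)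
    with T show False by simp
  qed
  moreover have "vec.dim (vec.span (T \<union> H)) \<le> vec.dim A" using sub by (rule vec.dim_subset)
  ultimately have d: "vec.dim (vec.span (T \<union> H)) = vec.dim A" using H by simp
  show "vec.span (T \<union> H) = A" using sub d A by (intro subspace_eqI) auto
  show "vec.dim T = Suc (vec.dim (T \<inter> H))" using dim_join[OF T(1) H(1)] d H by simp
qed

text \<open>Induction on the codimension around one hyperplane \<open>H0\<close> of
  \<open>T\<close>, without dual spaces. Every other hyperplane meets \<open>H0\<close> in a
  hyperplane \<open>M\<close> of \<open>H0\<close>, and each such \<open>M\<close> lies in
  \<open>q + 1\<close> hyperplanes of \<open>T\<close>, one of them \<open>H0\<close>. This is the
  recursion \<open>1 + q * qint q d\<close>.\<close>

lemma card_hyperplanes_above: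
  fixes A T :: "('a::{field,finite}^'n::finite) set"
  assumes A: "vec.subspace A" and T: "vec.subspace T" and AT: "A \<subseteq> T"
    and d: "vec.dim T = vec.dim A + d" "d \<ge> 1"
  shows "card (between A T (vec.dim T - 1)) = qint CARD('a) d"
  using T AT d
proof (induction d arbitrary: T)
  case 0
  then show ?case by simp
next
  case (Suc d)
  show ?case
  proof (cases "d = 0")
    case True
    then have "between A T (vec.dim T - 1) = {A}"
      using Suc.prems A by (auto simp: between_def dest: subspace_eqI[OF A])
    then show ?thesis using True by simp
  next
    case False
    let ?L = "between A T (vec.dim T - 1)" and ?q = "CARD('a)"
    obtain H0 where H0: "H0 \<in> ?L"
      using between_nonempty[OF A Suc.prems(1,2), of "vec.dim T - 1"] Suc.prems by auto
    note H0' = betweenD[OF H0]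
    have dimH0: "vec.dim H0 = vec.dim A + d" "vec.dim T = Suc (vec.dim H0)"
      using H0' Suc.prems by auto
    let ?M = "between A H0 (vec.dim H0 - 1)"
    have cM: "card ?M = qint ?q d"
      using Suc.IH[OF H0'(1,2) dimH0(1)] False by simp
    let ?N = "\<lambda>M. between M T (Suc (vec.dim M)) - {H0}"
    have Int: "H \<inter> H0 \<in> ?M" "Suc (vec.dim (H \<inter> H0)) = vec.dim H" if H: "H \<in> ?L" "H \<noteq> H0" for H
    proof -
      note H' = betweenD[OF H(1)]
      have n: "\<not> H \<subseteq> H0" using subspace_eqI[of H H0] H' H0' H by auto
      have "vec.dim H = Suc (vec.dim (H \<inter> H0))"
        by (rule hyperplane_Int[OF Suc.prems(1) H0'(1,3) dimH0(2) H'(1,3) n])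
      then show "H \<inter> H0 \<in> ?M" "Suc (vec.dim (H \<inter> H0)) = vec.dim H"
        using H' H0' by (auto intro!: betweenI vec.subspace_inter)
    qed
    have un: "?L - {H0} = (\<Union>M\<in>?M. ?N M)"
    proof (intro subset_antisym subsetI)
      fix H assume "H \<in> ?L - {H0}"
      then show "H \<in> (\<Union>M\<in>?M. ?N M)"
        using Int[of H] by (intro UN_I[of "H \<inter> H0"]) (auto simp: between_def)
    next
      fix H assume "H \<in> (\<Union>M\<in>?M. ?N M)"
      then show "H \<in> ?L - {H0}"
        using dimH0 False Suc.prems by (auto simp: between_def)
    qed
    have uniq: "M = H \<inter> H0" if M: "M \<in> ?M" "H \<in> ?N M" for M H
    proof -
      have H: "H \<in> ?L" "H \<noteq> H0"
        using M dimH0 False Suc.prems by (auto simp: between_def)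
      show ?thesis
        using Int[OF H] M by (intro subspace_eqI) (auto simp: between_def)
    qed
    have "?N M \<inter> ?N M' = {}" if "M \<in> ?M" "M' \<in> ?M" "M \<noteq> M'" for M M'
      using uniq[OF that(1)] uniq[OF that(2)] that(3) by blast
    then have "card (?L - {H0}) = (\<Sum>M\<in>?M. card (?N M))"
      unfolding un by (intro card_UN_disjoint) simp_all
    also have "\<dots> = (\<Sum>M\<in>?M. ?q)"
    proof (rule sum.cong)
      fix M assume M: "M \<in> ?M"
      note M' = betweenD[OF M]
      have dimM: "vec.dim H0 = Suc (vec.dim M)" using M'(4) dimH0 False by simp
      have "card (between M T (Suc (vec.dim M))) = qint ?q 2"
        using card_points_above[OF M'(1) Suc.prems(1)] M'(3) H0'(3) dimM dimH0 by (simp add: numeral_2_eq_2)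
      moreover have "H0 \<in> between M T (Suc (vec.dim M))"
        using M'(3) H0' dimM by (intro betweenI) simp_all
      ultimately show "card (?N M) = ?q" by (simp add: numeral_2_eq_2)
    qed simp
    finally have "card ?L - 1 = qint ?q d * ?q"
      using H0 cM by simp
    moreover have "card ?L > 0" using H0 by (auto simp: card_gt_0_iff)
    ultimately have "card ?L = 1 + ?q * qint ?q d" by (simp add: mult.commute[of ?q])
    then show ?thesis by (simp only: qint_shift)
  qed
qed

text \<open>Incident pairs of dimensions \<open>j\<close> and \<open>j + 1\<close> are counted
  twice: \<open>card_points_above\<close> gives the number of covers,
  \<open>card_hyperplanes_above\<close> the number of subspaces covered, and their quotient is the
  ratio of consecutive Gaussian coefficients.\<close>

lemma card_between:
  fixes S B :: "('a::{field,finite}^'n::finite) set"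
  assumes S: "vec.subspace S" and B: "vec.subspace B" and SB: "S \<subseteq> B"
    and j: "vec.dim S \<le> j" "j \<le> vec.dim B"
  shows "real (card (between S B j)) = gauss CARD('a) (vec.dim B - vec.dim S) (j - vec.dim S)"
  using j
proof (induction j rule: dec_induct)
  case base
  have "between S B (vec.dim S) = {S}"
    using S SB by (auto simp: between_def dest: subspace_eqI[OF S])
  then show ?case by simp
next
  case (step j)
  let ?q = "CARD('a)" and ?s = "vec.dim S" and ?b = "vec.dim B"
  have q: "?q \<ge> 2" by (rule card_field_ge_2)
  have "(\<Sum>U\<in>between S B j. card {W \<in> between S B (Suc j). U \<subseteq> W})
      = (\<Sum>W\<in>between S B (Suc j). card {U \<in> between S B j. U \<subseteq> W})"
    by (rule card_double_count) simp_all
  moreover have "card {W \<in> between S B (Suc j). U \<subseteq> W} = qint ?q (?b - j)" if U: "U \<in> between S B j" for U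
  proof -
    have "{W \<in> between S B (Suc j). U \<subseteq> W} = between U B (Suc (vec.dim U))"
      using U by (auto simp: between_def)
    then show ?thesis using card_points_above[of U B] U B by (simp add: between_def)
  qed
  moreover have "card {U \<in> between S B j. U \<subseteq> W} = qint ?q (Suc j - ?s)" if W: "W \<in> between S B (Suc j)" for W
  proof -
    have "{U \<in> between S B j. U \<subseteq> W} = between S W (vec.dim W - 1)"
      using W by (auto simp: between_def)
    then show ?thesis using card_hyperplanes_above[of S W "Suc j - ?s"] W S step.hyps
      by (simp add: between_def)
  qed
  ultimately have "card (between S B j) * qint ?q (?b - j) = card (between S B (Suc j)) * qint ?q (Suc j - ?s)"
    by simp
  then have "real (card (between S B j)) * (qint ?q (?b - j) * (real ?q - 1))
      = real (card (between S B (Suc j))) * (qint ?q (Suc j - ?s) * (real ?q - 1))"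
    by (simp only: mult.assoc[symmetric] of_nat_mult[symmetric])
  then have "real (card (between S B (Suc j))) * (real ?q ^ (Suc j - ?s) - 1)
     = gauss ?q (?b - ?s) (j - ?s) * (real ?q ^ (?b - j) - 1)"
    using step by (simp add: qint_mult)
  also have "\<dots> = gauss ?q (?b - ?s) (Suc j - ?s) * (real ?q ^ (Suc j - ?s) - 1)"
    using gauss_Suc_right[OF q, of "j - ?s" "?b - ?s"] step.hyps step.prems by (simp add: Suc_diff_le)
  finally show ?case
    using q_power_gt_1[OF q, of "Suc j - ?s"] step.hyps by simp
qed

section \<open>The shadow inequality\<close>

lemma gauss_1:
  assumes "q \<ge> 2" "n \<ge> 1"
  shows "gauss q n 1 * (real q - 1) = real q ^ n - 1"
  using gauss_Suc_right[of q 0 n] assms by simp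

lemma between_mono: "S' \<subseteq> S \<Longrightarrow> A \<subseteq> A' \<Longrightarrow> between S A j \<subseteq> between S' A' j"
  by (auto simp: between_def)

text \<open>The counterpart of the cliques spanned by a uniform hypergraph, with superspaces in
  place of subsets. A family of \<open>s\<close>-dimensional subspaces of \<open>A\<close> lies in
  \<open>full_below\<close> of its own upper shadow, so upper bounds here are lower bounds for
  shadows.\<close>

definition full_below :: "('a::field^'n::finite) set \<Rightarrow> nat \<Rightarrow> ('a^'n) set set \<Rightarrow> ('a^'n) set set" where
  "full_below A s G = {S \<in> between {0} A s. between S A (Suc s) \<subseteq> G}"

text \<open>A full \<open>S\<close> inside \<open>H\<close> has
  \<open>qint q (r+1) - qint q r = q^r\<close> covers that leave \<open>H\<close>; all of them are
  in \<open>G\<close>, and each determines \<open>S\<close> as its intersection with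
  \<open>H\<close>. The members of \<open>G\<close> inside \<open>H\<close> are added on both sides
  for the later comparison with \<open>card G\<close>.\<close>

lemma full_below_hyperplane_count:
  fixes A H :: "('a::{field,finite}^'n::finite) set"
  assumes A: "vec.subspace A" "vec.dim A = Suc (s + r)" 
    and H: "H \<in> between {0} A (s + r)"
    and G: "G \<subseteq> between {0} A (Suc s)"
  shows "CARD('a) ^ r * card {S \<in> full_below A s G. S \<subseteq> H} + card {T \<in> G. T \<subseteq> H}
      = card {T \<in> G. T \<subseteq> H} + card {T \<in> G. \<not> T \<subseteq> H \<and> T \<inter> H \<in> full_below A s G}"
proof -
  let ?K = "{S \<in> full_below A s G. S \<subseteq> H}" and ?q = "CARD('a)"
  let ?N = "\<lambda>S. between S A (Suc s) - between S H (Suc s)"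
  note H' = betweenD[OF H]
  have Int: "S = T \<inter> H" "T \<in> G" "\<not> T \<subseteq> H" if S: "S \<in> ?K" and T: "T \<in> ?N S" for S T
  proof -
    have T1: "T \<in> between S A (Suc s)" and T2: "\<not> T \<subseteq> H" using T by (auto simp: between_def)
    note T' = betweenD[OF T1]
    have S1: "S \<in> between {0} A s" using S by (simp add: full_below_def)
    note S' = betweenD[OF S1]
    show "\<not> T \<subseteq> H" by fact
    show "T \<in> G" using S T1 by (auto simp: full_below_def)
    have "vec.dim T = Suc (vec.dim (T \<inter> H))"
      using hyperplane_Int(1)[OF A(1) H'(1,3) _ T'(1,3) T2] A H' by simp
    then show "S = T \<inter> H"
      using S S' T' H' by (intro subspace_eqI vec.subspace_inter) auto
  qed
  have "{T \<in> G. \<not> T \<subseteq> H \<and> T \<inter> H \<in> full_below A s G} = (\<Union>S\<in>?K. ?N S)"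
  proof (intro subset_antisym subsetI)
    fix T assume T: "T \<in> {T \<in> G. \<not> T \<subseteq> H \<and> T \<inter> H \<in> full_below A s G}"
    then have "T \<in> between (T \<inter> H) A (Suc s)" using G by (auto simp: between_def)
    with T show "T \<in> (\<Union>S\<in>?K. ?N S)" by (intro UN_I[of "T \<inter> H"]) (auto simp: between_def)
  next
    fix T assume "T \<in> (\<Union>S\<in>?K. ?N S)"
    then obtain S where S: "S \<in> ?K" "T \<in> ?N S" by blast
    show "T \<in> {T \<in> G. \<not> T \<subseteq> H \<and> T \<inter> H \<in> full_below A s G}"
      using Int[OF S] S(1) by simp
  qed
  moreover have "card (\<Union>S\<in>?K. ?N S) = (\<Sum>S\<in>?K. card (?N S))"
    using Int(1) by (intro card_UN_disjoint) (simp_all, blast)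
  moreover have "card (?N S) = ?q ^ r" if S: "S \<in> ?K" for S
  proof -
    have S1: "S \<in> between {0} A s" and SH: "S \<subseteq> H" using S by (simp_all add: full_below_def)
    note S' = betweenD[OF S1]
    have "between S H (Suc s) \<subseteq> between S A (Suc s)" using H' by (intro between_mono) auto
    then have "card (?N S) = card (between S A (Suc s)) - card (between S H (Suc s))"
      by (simp add: card_Diff_subset)
    also have "\<dots> = qint ?q (Suc r) - qint ?q r"
      using card_points_above[OF S'(1) A(1) S'(3)] card_points_above[OF S'(1) H'(1) SH]
      unfolding S'(4) A(2) H'(4) by (simp add: Suc_diff_le)
    finally show ?thesis by simp
  qed
  ultimately show ?thesis by simp
qed

lemma card_split: "finite G \<Longrightarrow> card {T \<in> G. P T} + card {T \<in> G. \<not> P T} = card G"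
  by (subst card_Un_disjoint[symmetric]) (auto intro!: arg_cong[of _ _ card])

text \<open>Dropping the condition on \<open>T \<inter> H\<close> can only enlarge the count. If
  nothing is lost, every member of \<open>G\<close> outside \<open>H\<close> has a full trace on
  \<open>H\<close>; this is the source of all structure in the equality case.\<close>

lemma full_below_hyperplane_le:
  fixes A H :: "('a::{field,finite}^'n::finite) set"
  assumes "vec.subspace A" "vec.dim A = Suc (s + r)" 
    and "H \<in> between {0} A (s + r)" and "G \<subseteq> between {0} A (Suc s)"
  shows "CARD('a) ^ r * card {S \<in> full_below A s G. S \<subseteq> H} + card {T \<in> G. T \<subseteq> H} \<le> card G"
    and "CARD('a) ^ r * card {S \<in> full_below A s G. S \<subseteq> H} + card {T \<in> G. T \<subseteq> H} = card G \<Longrightarrow>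
      T \<in> G \<Longrightarrow> \<not> T \<subseteq> H \<Longrightarrow> T \<inter> H \<in> full_below A s G"
proof -
  let ?X = "{T \<in> G. \<not> T \<subseteq> H \<and> T \<inter> H \<in> full_below A s G}" and ?Y = "{T \<in> G. \<not> T \<subseteq> H}"
  have XY: "?X \<subseteq> ?Y" by blast
  have le: "card ?X \<le> card ?Y" using XY by (intro card_mono) simp_all
  have sp: "card {T \<in> G. T \<subseteq> H} + card ?Y = card G" by (rule card_split) simp
  note c = full_below_hyperplane_count[OF assms]
  show "CARD('a) ^ r * card {S \<in> full_below A s G. S \<subseteq> H} + card {T \<in> G. T \<subseteq> H} \<le> card G"
    using c le sp by linarith
  assume "CARD('a) ^ r * card {S \<in> full_below A s G. S \<subseteq> H} + card {T \<in> G. T \<subseteq> H} = card G"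
  then have "card ?X = card ?Y" using c sp by linarith
  then have "?X = ?Y" using XY by (intro card_subset_eq) simp_all
  then show "T \<in> G \<Longrightarrow> \<not> T \<subseteq> H \<Longrightarrow> T \<inter> H \<in> full_below A s G" by blast
qed

text \<open>Double counting: each \<open>t\<close>-dimensional subspace lies in the same number of
  hyperplanes of \<open>A\<close>.\<close>

lemma sum_hyperplanes:
  fixes A :: "('a::{field,finite}^'n::finite) set"
  assumes A: "vec.subspace A" "vec.dim A = Suc (s + r)" and G: "G \<subseteq> between {0} A t"
    and t: "t + d = Suc (s + r)" "d \<ge> 1"
  shows "(\<Sum>H\<in>between {0} A (s + r). card {T \<in> G. T \<subseteq> H}) = card G * qint CARD('a) d"
proof -
  have "(\<Sum>H\<in>between {0} A (s + r). card {T \<in> G. T \<subseteq> H})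
      = (\<Sum>T\<in>G. card {H \<in> between {0} A (s + r). T \<subseteq> H})"
    by (rule card_double_count) simp_all
  also have "\<dots> = (\<Sum>T\<in>G. qint CARD('a) d)"
  proof (rule sum.cong[OF refl])
    fix T assume "T \<in> G"
    then have T: "T \<in> between {0} A t" using G by blast
    note T' = betweenD[OF T]
    have "{H \<in> between {0} A (s + r). T \<subseteq> H} = between T A (vec.dim A - 1)"
      using T' A by (auto simp: between_def vec.subspace_0)
    then show "card {H \<in> between {0} A (s + r). T \<subseteq> H} = qint CARD('a) d"
      using card_hyperplanes_above[OF T'(1) A(1) T'(3), of d] T' A t by simp
  qed
  finally show ?thesis by simp
qed

lemma full_below_link:
  assumes "H \<subseteq> A"
  shows "{S \<in> full_below A s G. S \<subseteq> H} \<subseteq> full_below H s {T \<in> G. T \<subseteq> H}"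
proof
  fix S assume "S \<in> {S \<in> full_below A s G. S \<subseteq> H}"
  then have S: "S \<in> between {0} A s" "between S A (Suc s) \<subseteq> G" "S \<subseteq> H" by (simp_all add: full_below_def)
  have "between S H (Suc s) \<subseteq> {T \<in> G. T \<subseteq> H}"
    using between_mono[OF subset_refl assms] S(2) betweenD(3)[of _ S H] by blast
  then show "S \<in> full_below H s {T \<in> G. T \<subseteq> H}"
    using S by (simp add: full_below_def between_def)
qed

text \<open>The case where \<open>H\<close> contains at least the fraction
  \<open>(q^r - 1)/(q^a - 1)\<close> of \<open>G\<close>; for \<open>a = s + r\<close> this is the
  fraction of a star inside a hyperplane through its centre. Few members of \<open>G\<close> are
  then left outside \<open>H\<close>, and each full \<open>S\<close> uses up \<open>q^r\<close> of
  them.\<close>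

lemma card_full_below_local:
  fixes A :: "('a::{field,finite}^'n::finite) set"
  assumes A: "vec.subspace A" "vec.dim A = Suc (s + r)"
    and G: "G \<subseteq> between {0} A (Suc s)"
    and r: "r \<ge> 1" "r \<le> a" and H: "H \<in> between {0} A (s + r)"
    and big: "real (card {T \<in> G. T \<subseteq> H}) * (real CARD('a) ^ a - 1) \<ge> real (card G) * (real CARD('a) ^ r - 1)"
  shows "real (card {S \<in> full_below A s G. S \<subseteq> H}) * (real CARD('a) ^ r - 1)
      \<le> real (card {T \<in> G. T \<subseteq> H}) * (real CARD('a) ^ (a - r) - 1)" (is "?k * ?x \<le> ?d * ?y")
    and "real (card {S \<in> full_below A s G. S \<subseteq> H}) * (real CARD('a) ^ r - 1)
      = real (card {T \<in> G. T \<subseteq> H}) * (real CARD('a) ^ (a - r) - 1) \<Longrightarrow>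
      real (card {T \<in> G. T \<subseteq> H}) * (real CARD('a) ^ a - 1) = real (card G) * (real CARD('a) ^ r - 1)
      \<and> CARD('a) ^ r * card {S \<in> full_below A s G. S \<subseteq> H} + card {T \<in> G. T \<subseteq> H} = card G"
proof -
  let ?Q = "real CARD('a) ^ r" and ?g = "real (card G)"
  have q: "CARD('a) \<ge> 2" by (rule card_field_ge_2)
  have Qp: "?Q > 1" using q_power_gt_1[OF q] r by simp
  have e: "real CARD('a) ^ a = ?Q * real CARD('a) ^ (a - r)" using r by (simp flip: power_add)
  have "CARD('a) ^ r * card {S \<in> full_below A s G. S \<subseteq> H} + card {T \<in> G. T \<subseteq> H} \<le> card G"
    by (rule full_below_hyperplane_le[OF A H G])
  then have "real (CARD('a) ^ r * card {S \<in> full_below A s G. S \<subseteq> H} + card {T \<in> G. T \<subseteq> H}) \<le> ?g"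
    by (simp only: of_nat_le_iff)
  then have c: "?Q * ?k + ?d \<le> ?g"
    by (simp only: of_nat_add of_nat_mult of_nat_power)
  then have c1: "(?Q * ?k) * ?x \<le> (?g - ?d) * ?x" using Qp by (intro mult_right_mono) auto
  have c2: "(?g - ?d) * ?x \<le> ?Q * (?d * ?y)"
    using big unfolding e by (simp add: algebra_simps)
  have "?Q * (?k * ?x) \<le> ?Q * (?d * ?y)" using order_trans[OF c1 c2] by (simp only: mult.assoc)
  then show "?k * ?x \<le> ?d * ?y" by (rule mult_left_le_imp_le) (use Qp in simp)
  assume "?k * ?x = ?d * ?y"
  then have eq: "(?Q * ?k) * ?x = ?Q * (?d * ?y)" by (simp add: mult_ac)
  have "(?Q * ?k) * ?x = (?g - ?d) * ?x" using eq c1 c2 by linarith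
  then have "?Q * ?k + ?d = ?g" using Qp by simp
  then have "CARD('a) ^ r * card {S \<in> full_below A s G. S \<subseteq> H} + card {T \<in> G. T \<subseteq> H} = card G"
    by (simp only: of_nat_add[symmetric] of_nat_mult[symmetric] of_nat_power[symmetric] of_nat_eq_iff)
  moreover have "(?g - ?d) * ?x = ?Q * (?d * ?y)" using eq c1 c2 by linarith
  then have "?d * (real CARD('a) ^ a - 1) = ?g * ?x"
    unfolding e by (simp add: algebra_simps)
  ultimately show "?d * (real CARD('a) ^ a - 1) = ?g * ?x \<and>
    CARD('a) ^ r * card {S \<in> full_below A s G. S \<subseteq> H} + card {T \<in> G. T \<subseteq> H} = card G" by simp
qed

text \<open>Each \<open>S\<close> lies in \<open>qint q (r+1)\<close> hyperplanes and each
  \<open>T\<close> in \<open>qint q r\<close>. Multiplication by \<open>q - 1\<close> turns these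
  numbers into powers minus one, so the local inequalities sum up to the global one times
  \<open>q^r - 1\<close>.\<close>

lemma full_below_sum:
  fixes A :: "('a::{field,finite}^'n::finite) set" and y :: real
  assumes A: "vec.subspace A" "vec.dim A = Suc (s + r)" and G: "G \<subseteq> between {0} A (Suc s)" and r: "r \<ge> 1"
  shows "(\<Sum>H\<in>between {0} A (s + r). real (card {T \<in> G. T \<subseteq> H}) * y
        - real (card {S \<in> full_below A s G. S \<subseteq> H}) * (real CARD('a) ^ r - 1)) * (real CARD('a) - 1)
      = (real (card G) * y - real (card (full_below A s G)) * (real CARD('a) ^ Suc r - 1)) * (real CARD('a) ^ r - 1)"
proof -
  let ?K = "full_below A s G" and ?q = "real CARD('a)"
  have K: "?K \<subseteq> between {0} A s" by (auto simp: full_below_def)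
  have rearr1: "(c * i * y - k * j * x) * p = c * (i * p) * y - k * (j * p) * x"
    and rearr2: "c * x * y - k * p * x = (c * y - k * p) * x" for c i y k j x p :: real
    by (simp_all add: algebra_simps)
  have "(\<Sum>H\<in>between {0} A (s + r). real (card {T \<in> G. T \<subseteq> H}) * y
        - real (card {S \<in> ?K. S \<subseteq> H}) * (?q ^ r - 1))
      = real (card G * qint CARD('a) r) * y - real (card ?K * qint CARD('a) (Suc r)) * (?q ^ r - 1)"
    unfolding sum_subtractf sum_distrib_right[symmetric] of_nat_sum[symmetric]
      sum_hyperplanes[OF A K, of "Suc r", simplified] sum_hyperplanes[OF A G, of r, simplified]
    using r by (simp add: sum_hyperplanes[OF A G, of r])
  then have "(\<Sum>H\<in>between {0} A (s + r). real (card {T \<in> G. T \<subseteq> H}) * y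
        - real (card {S \<in> ?K. S \<subseteq> H}) * (?q ^ r - 1)) * (?q - 1)
      = real (card G) * (qint CARD('a) r * (?q - 1)) * y
        - real (card ?K) * (qint CARD('a) (Suc r) * (?q - 1)) * (?q ^ r - 1)"
    by (simp only: of_nat_mult rearr1)
  then show ?thesis
    unfolding qint_mult by (simp only: rearr2)
qed

text \<open>By the local bound all summands in \<open>full_below_sum\<close> are nonnegative. If the
  global bound is attained, the sum vanishes and so does every summand.\<close>

lemma full_below_global:
  fixes A :: "('a::{field,finite}^'n::finite) set" and y :: real
  assumes A: "vec.subspace A" "vec.dim A = Suc (s + r)" and G: "G \<subseteq> between {0} A (Suc s)" and r: "r \<ge> 1"
    and loc: "\<And>H. H \<in> between {0} A (s + r) \<Longrightarrow>
      real (card {S \<in> full_below A s G. S \<subseteq> H}) * (real CARD('a) ^ r - 1) \<le> real (card {T \<in> G. T \<subseteq> H}) * y"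
  shows "real (card (full_below A s G)) * (real CARD('a) ^ Suc r - 1) \<le> real (card G) * y"
    and "real (card (full_below A s G)) * (real CARD('a) ^ Suc r - 1) = real (card G) * y \<Longrightarrow>
      H \<in> between {0} A (s + r) \<Longrightarrow>
      real (card {S \<in> full_below A s G. S \<subseteq> H}) * (real CARD('a) ^ r - 1) = real (card {T \<in> G. T \<subseteq> H}) * y"
proof -
  let ?f = "\<lambda>H. real (card {T \<in> G. T \<subseteq> H}) * y
        - real (card {S \<in> full_below A s G. S \<subseteq> H}) * (real CARD('a) ^ r - 1)"
  have q: "CARD('a) \<ge> 2" by (rule card_field_ge_2)
  then have q1: "real CARD('a) - 1 > 0" by simp
  have q2: "real CARD('a) ^ r - 1 > 0" using q_power_gt_1[OF q, of r] r by simp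
  note eq = full_below_sum[OF A G r, of y]
  have nn: "0 \<le> ?f H" if "H \<in> between {0} A (s + r)" for H using loc[OF that] by simp
  have "0 \<le> (\<Sum>H\<in>between {0} A (s + r). ?f H) * (real CARD('a) - 1)"
    using q1 nn by (intro mult_nonneg_nonneg sum_nonneg) auto
  then show "real (card (full_below A s G)) * (real CARD('a) ^ Suc r - 1) \<le> real (card G) * y"
    unfolding eq using q2 by (simp add: zero_le_mult_iff)
  assume t: "real (card (full_below A s G)) * (real CARD('a) ^ Suc r - 1) = real (card G) * y"
    and H: "H \<in> between {0} A (s + r)"
  then have "(\<Sum>H\<in>between {0} A (s + r). ?f H) = 0" using eq q1 by simp
  then have "?f H = 0" using nn H by (subst (asm) sum_nonneg_eq_0_iff) auto
  then show "real (card {S \<in> full_below A s G. S \<subseteq> H}) * (real CARD('a) ^ r - 1)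
      = real (card {T \<in> G. T \<subseteq> H}) * y" by simp
qed

text \<open>This drives the induction: a hyperplane with at most the star fraction of the family
  inherits the size hypothesis, with both parameters of the Gaussian coefficient lowered by
  one.\<close>

lemma gauss_link_bound:
  assumes q: "q \<ge> 2" and r: "Suc r \<le> Suc a"
    and g: "g \<le> gauss q (Suc a) (Suc r)" and d: "d * (real q ^ Suc a - 1) \<le> g * (real q ^ Suc r - 1)"
  shows "d \<le> gauss q a r"
proof -
  have "d * (real q ^ Suc a - 1) \<le> g * (real q ^ Suc r - 1)" by fact
  also have "\<dots> \<le> gauss q (Suc a) (Suc r) * (real q ^ Suc r - 1)"
    using g q_power_gt_1[OF q, of "Suc r"] by (intro mult_right_mono) auto
  also have "\<dots> = gauss q a r * (real q ^ Suc a - 1)"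
    using gauss_Suc_Suc[OF q, of r a] r by simp
  finally show ?thesis using q_power_gt_1[OF q, of "Suc a"] by simp
qed

text \<open>Induction on \<open>r\<close>, the codimension in \<open>A\<close> of the members of
  \<open>G\<close>. If \<open>H\<close> contains the star fraction of \<open>G\<close>, one counts
  outside \<open>H\<close>. Otherwise the members inside \<open>H\<close> satisfy the hypothesis for
  \<open>r - 1\<close> and \<open>a - 1\<close>, and the local bounds inside \<open>H\<close> sum up
  to the bound at \<open>H\<close>.\<close>

lemma full_below_local_le:
  fixes A :: "('a::{field,finite}^'n::finite) set"
  assumes "vec.subspace A" "vec.dim A = Suc (s + r)"
    and "G \<subseteq> between {0} A (Suc s)"
    and "r \<ge> 1" "r \<le> a" and "real (card G) \<le> gauss CARD('a) a r"
    and "H \<in> between {0} A (s + r)"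
  shows "real (card {S \<in> full_below A s G. S \<subseteq> H}) * (real CARD('a) ^ r - 1)
      \<le> real (card {T \<in> G. T \<subseteq> H}) * (real CARD('a) ^ (a - r) - 1)"
  using assms
proof (induction r arbitrary: A a G H)
  case 0
  then show ?case by simp
next
  case (Suc r)
  let ?q = "real CARD('a)"
  have q: "CARD('a) \<ge> 2" by (rule card_field_ge_2)
  have q1: "?q > 1" using q by simp
  note A = Suc.prems(1,2) and G = Suc.prems(3) and r = Suc.prems(4,5) and cG = Suc.prems(6)
    and H = Suc.prems(7)
  note H' = betweenD[OF H]
  let ?d = "real (card {T \<in> G. T \<subseteq> H})" and ?k = "real (card {S \<in> full_below A s G. S \<subseteq> H})"
  obtain a' where a': "a = Suc a'" using r by (cases a) auto
  show ?case
  proof (cases "?d * (?q ^ a - 1) \<ge> real (card G) * (?q ^ Suc r - 1)")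
    case True
    then show ?thesis by (rule card_full_below_local(1)[OF A G r H])
  next
    case False
    then have d: "?d \<le> gauss CARD('a) a' r"
      using gauss_link_bound[OF q, of r a' "real (card G)" ?d] cG r a' by auto
    show ?thesis
    proof (cases "r = 0")
      \<comment> \<open>The members of \<open>G\<close> are now hyperplanes of \<open>A\<close>, so
        only \<open>H\<close> itself could be a member inside \<open>H\<close>. Less than one member
        means that \<open>H\<close> is not in \<open>G\<close>, and then no \<open>S\<close> below
        \<open>H\<close> is full.\<close>
      case True
      have "?d * (?q ^ a - 1) < real (card G) * (?q - 1)" using False True by simp
      also have "\<dots> \<le> gauss CARD('a) a 1 * (?q - 1)"
        using cG True q1 by (intro mult_right_mono) auto
      also have "\<dots> = 1 * (?q ^ a - 1)"
        using gauss_1[OF q, of a] a' by simp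
      finally have "?d < 1" using q_power_gt_1[OF q, of a] a' by simp
      then have d0: "{T \<in> G. T \<subseteq> H} = {}" by (simp add: card_eq_0_iff)
      have k0: "{S \<in> full_below A s G. S \<subseteq> H} = {}"
      proof (rule ccontr)
        assume "{S \<in> full_below A s G. S \<subseteq> H} \<noteq> {}"
        then obtain S where S: "between S A (Suc s) \<subseteq> G" "S \<subseteq> H" by (auto simp: full_below_def)
        have "H \<in> between S A (Suc s)" using H' True S(2) by (simp add: between_def)
        then show False using d0 S by blast
      qed
      show ?thesis unfolding d0 k0 by simp
    next
      case nz: False
      have "?k \<le> real (card (full_below H s {T \<in> G. T \<subseteq> H}))"
        using full_below_link[OF H'(3)] by (simp add: card_mono)
      then have "?k * (?q ^ Suc r - 1) \<le> real (card (full_below H s {T \<in> G. T \<subseteq> H})) * (?q ^ Suc r - 1)"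
        using q_power_gt_1[OF q, of "Suc r"] by (intro mult_right_mono) auto
      also have "\<dots> \<le> ?d * (?q ^ (a' - r) - 1)"
      proof -
        have 1: "vec.dim H = Suc (s + r)" "1 \<le> r" "{T \<in> G. T \<subseteq> H} \<subseteq> between {0} H (Suc s)"
          using H' nz G by (auto simp: between_def)
        have d': "real (card {T \<in> G. T \<subseteq> H}) \<le> gauss CARD('a) a' r" "r \<le> a'" using r a' d by auto
        show ?thesis
          by (rule full_below_global(1)[OF H'(1) 1(1,3,2) Suc.IH[OF H'(1) 1(1,3,2) d'(2,1)]])
      qed
      finally show ?thesis using a' by simp
    qed
  qed
qed

lemmas card_full_below_le = full_below_global(1)[OF _ _ _ _ full_below_local_le]

text \<open>Global equality means equality at every hyperplane. At an \<open>H\<close> containing a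
  member of \<open>G\<close>, less than the star fraction would by induction force the value
  \<open>gauss q (a - 1) (r - 1)\<close>, which is not below that fraction. So the fraction is exact
  and the count outside \<open>H\<close> is tight.\<close>

lemma full_below_tight:
  fixes A :: "('a::{field,finite}^'n::finite) set"
  assumes "vec.subspace A" "vec.dim A = Suc (s + r)"
    and "G \<subseteq> between {0} A (Suc s)"
    and "r \<ge> 1" "r \<le> a" and "real (card G) \<le> gauss CARD('a) a r" and "G \<noteq> {}"
    and "real (card (full_below A s G)) * (real CARD('a) ^ Suc r - 1)
      = real (card G) * (real CARD('a) ^ (a - r) - 1)"
  shows "real (card G) = gauss CARD('a) a r \<and>
    (\<forall>H\<in>between {0} A (s + r). {T \<in> G. T \<subseteq> H} \<noteq> {} \<longrightarrow>
      real (card {T \<in> G. T \<subseteq> H}) * (real CARD('a) ^ a - 1) = real (card G) * (real CARD('a) ^ r - 1)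
      \<and> CARD('a) ^ r * card {S \<in> full_below A s G. S \<subseteq> H} + card {T \<in> G. T \<subseteq> H} = card G)"
  using assms
proof (induction r arbitrary: A a G)
  case 0
  then show ?case by simp
next
  case (Suc r)
  let ?q = "real CARD('a)"
  have q: "CARD('a) \<ge> 2" by (rule card_field_ge_2)
  note A = Suc.prems(1,2) and G = Suc.prems(3) and r = Suc.prems(4,5) and cG = Suc.prems(6)
  obtain a' where a': "a = Suc a'" using r by (cases a) auto
  let ?d = "\<lambda>H. real (card {T \<in> G. T \<subseteq> H})" and ?k = "\<lambda>H. real (card {S \<in> full_below A s G. S \<subseteq> H})"
  \<comment> \<open>The inequality on \<open>?d H\<close> is weak because the fact serves twice:
    strictly below the star fraction for a contradiction, and at the exact fraction to compute
    \<open>card G\<close>.\<close>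
  have link: "?d H = gauss CARD('a) a' r"
    if H: "H \<in> between {0} A (s + Suc r)" and ne: "{T \<in> G. T \<subseteq> H} \<noteq> {}"
      and d: "?d H * (?q ^ a - 1) \<le> real (card G) * (?q ^ Suc r - 1)" for H
  proof (cases "r = 0")
    case True
    note H' = betweenD[OF H]
    have "T = H" if "T \<in> G" "T \<subseteq> H" for T
    proof -
      have "T \<in> between {0} A (Suc s)" using G that by blast
      then show ?thesis using H' True \<open>T \<subseteq> H\<close> by (intro subspace_eqI) (auto simp: between_def)
    qed
    then have "{T \<in> G. T \<subseteq> H} = {H}" using ne by blast
    then show ?thesis using True by simp
  next
    case nz: False
    note H' = betweenD[OF H]
    let ?G = "{T \<in> G. T \<subseteq> H}"
    have d': "?d H \<le> gauss CARD('a) a' r"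
      using gauss_link_bound[OF q, of r a' "real (card G)" "?d H"] cG r a' d by auto
    have L: "vec.dim H = Suc (s + r)" "?G \<subseteq> between {0} H (Suc s)" "1 \<le> r" "r \<le> a'"
      using H' nz G r a' by (auto simp: between_def)
    have "?k H \<le> real (card (full_below H s ?G))"
      using full_below_link[OF H'(3)] by (simp add: card_mono)
    then have "?k H * (?q ^ Suc r - 1) \<le> real (card (full_below H s ?G)) * (?q ^ Suc r - 1)"
      using q_power_gt_1[OF q, of "Suc r"] by (intro mult_right_mono) auto
    moreover have "real (card (full_below H s ?G)) * (?q ^ Suc r - 1) \<le> ?d H * (?q ^ (a' - r) - 1)"
      by (rule card_full_below_le[OF H'(1) L(1,2,3) H'(1) L d'])
    moreover have "?k H * (?q ^ Suc r - 1) = ?d H * (?q ^ (a' - r) - 1)"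
      using full_below_global(2)[OF A G r(1) full_below_local_le[OF A G r cG] Suc.prems(8) H] a' by simp
    ultimately have "real (card (full_below H s ?G)) * (?q ^ Suc r - 1) = ?d H * (?q ^ (a' - r) - 1)"
      by linarith
    then show ?thesis using Suc.IH[OF H'(1) L d' ne] by blast
  qed
  have eqs: "?d H * (?q ^ a - 1) = real (card G) * (?q ^ Suc r - 1)
      \<and> CARD('a) ^ Suc r * card {S \<in> full_below A s G. S \<subseteq> H} + card {T \<in> G. T \<subseteq> H} = card G"
    if H: "H \<in> between {0} A (s + Suc r)" and ne: "{T \<in> G. T \<subseteq> H} \<noteq> {}" for H
  proof (rule card_full_below_local(2)[OF A G r H])
    show "?k H * (?q ^ Suc r - 1) = ?d H * (?q ^ (a - Suc r) - 1)"
      using full_below_global(2)[OF A G r(1) full_below_local_le[OF A G r cG] Suc.prems(8) H] .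
    show "real (card G) * (?q ^ Suc r - 1) \<le> ?d H * (?q ^ a - 1)"
    proof (rule ccontr)
      assume n: "\<not> ?thesis"
      then have "?d H = gauss CARD('a) a' r" using link[OF H ne] by simp
      then have "?d H * (?q ^ a - 1) = gauss CARD('a) a (Suc r) * (?q ^ Suc r - 1)"
        using gauss_Suc_Suc[OF q, of r a'] r a' by simp
      also have "\<dots> \<ge> real (card G) * (?q ^ Suc r - 1)"
        using cG q_power_gt_1[OF q, of "Suc r"] by (intro mult_right_mono) auto
      finally show False using n by simp
    qed
  qed
  obtain T where T: "T \<in> G" using Suc.prems(7) by blast
  then have T1: "T \<in> between {0} A (Suc s)" using G by blast
  note T' = betweenD[OF T1]
  obtain H where H: "H \<in> between T A (s + Suc r)"
    using between_nonempty[OF T'(1) A(1) T'(3), of "s + Suc r"] T' A by auto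
  then have H1: "H \<in> between {0} A (s + Suc r)" and ne: "{T \<in> G. T \<subseteq> H} \<noteq> {}"
    using T T' by (auto simp: between_def)
  have "real (card G) * (?q ^ Suc r - 1) = gauss CARD('a) a' r * (?q ^ a - 1)"
    using eqs[OF H1 ne] link[OF H1 ne] by simp
  also have "\<dots> = gauss CARD('a) a (Suc r) * (?q ^ Suc r - 1)"
    using gauss_Suc_Suc[OF q, of r a'] r a' by simp
  finally have "real (card G) = gauss CARD('a) a (Suc r)"
    using q_power_gt_1[OF q, of "Suc r"] by simp
  then show ?case using eqs by simp
qed

section \<open>Subspaces in general position, pencils of hyperplanes, and stars as the equality
  case\<close>

lemma avoid_subspace:
  fixes A S U :: "('a::field^'n::finite) set"
  assumes A: "vec.subspace A" and S: "vec.subspace S" "S \<subseteq> A" and U: "vec.subspace U" "U \<subseteq> A"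
    and j: "vec.dim S \<le> j" "j + vec.dim U \<le> vec.dim A + vec.dim (S \<inter> U)"
  obtains W where "W \<in> between S A j" "W \<inter> U = S \<inter> U"
proof -
  have "\<exists>W. W \<in> between S A j \<and> W \<inter> U = S \<inter> U"
    using j
  proof (induction j rule: dec_induct)
    case base
    then show ?case using S by (intro exI[of _ S]) (simp add: between_def)
  next
    case (step j)
    then obtain W where W: "W \<in> between S A j" "W \<inter> U = S \<inter> U" by auto
    note W' = betweenD[OF W(1)]
    \<comment> \<open>A vector outside \<open>W + U\<close> extends \<open>W\<close> without
      enlarging its intersection with \<open>U\<close>. The bound on \<open>j\<close> keeps
      \<open>W + U\<close> a proper subspace of \<open>A\<close>.\<close>
    have "vec.dim (vec.span (W \<union> U)) < vec.dim A"
      using dim_join[OF W'(1) U(1)] W W' step.prems by simp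
    then have "\<not> A \<subseteq> vec.span (W \<union> U)"
      using vec.dim_subset[of A "vec.span (W \<union> U)"] by auto
    then obtain x where x: "x \<in> A" "x \<notin> vec.span (W \<union> U)" by blast
    have xW: "x \<notin> W" using x(2) vec.span_base[of x "W \<union> U"] by blast
    have 1: "vec.span (insert x W) \<in> between S A (Suc j)"
      using span_insert_between[OF W'(1) A x(1) xW W'(2,3)] W'(4) by simp
    have "y \<in> W" if y: "y \<in> vec.span (insert x W)" "y \<in> U" for y
    proof -
      obtain c where c: "y - c *s x \<in> W"
        using y(1) W'(1) by (auto simp: vec.span_insert vec.span_eq_iff[THEN iffD2])
      show ?thesis
      proof (cases "c = 0")
        case True
        then show ?thesis using c by simp
      next
        case False
        have "y - (y - c *s x) \<in> vec.span (W \<union> U)"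
          using c y(2) by (intro vec.span_diff vec.span_base) auto
        then have "c *s x \<in> vec.span (W \<union> U)" by simp
        then have "inverse c *s (c *s x) \<in> vec.span (W \<union> U)" by (rule vec.span_scale)
        then have "x \<in> vec.span (W \<union> U)" unfolding vector_smult_assoc using False by simp
        then show ?thesis using x(2) by simp
      qed
    qed
    then have "vec.span (insert x W) \<inter> U = W \<inter> U"
      using vec.span_base[of _ "insert x W"] by blast
    then show ?case using 1 W(2) by blast
  qed
  then show thesis using that by blast
qed

lemma avoid_point:
  fixes A T :: "('a::field^'n::finite) set"
  assumes A: "vec.subspace A" and T: "vec.subspace T" "T \<subseteq> A" and x: "x \<in> A" "x \<notin> T"
    and j: "vec.dim T \<le> j" "j < vec.dim A"
  obtains W where "W \<in> between T A j" "x \<notin> W"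
proof -
  have x0: "x \<noteq> 0" using x T vec.subspace_0 by blast
  have sub: "vec.span {x} \<subseteq> A" using A x by (intro vec.span_minimal) auto
  have Int: "T \<inter> vec.span {x} = {0}"
  proof -
    have "vec.dim (vec.span {x}) = 1" using x0 by (simp add: vec.dim_singleton)
    have "y = 0" if "y \<in> T" "y \<in> vec.span {x}" for y
    proof -
      obtain c where c: "y = c *s x" using \<open>y \<in> vec.span {x}\<close> by (auto simp: vec.span_singleton)
      have "c = 0"
      proof (rule ccontr)
        assume "c \<noteq> 0"
        have "inverse c *s y \<in> T" using T that by (simp add: vec.subspace_scale)
        then show False using x c \<open>c \<noteq> 0\<close> by (simp add: vector_smult_assoc)
      qed
      then show ?thesis using c by simp
    qed
    then show ?thesis using T by (auto simp: vec.subspace_0 vec.span_zero)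
  qed
  have "vec.dim (vec.span {x}) = 1" using x0 by (simp add: vec.dim_singleton)
  moreover have "vec.dim (T \<inter> vec.span {x}) = 0" unfolding Int by simp
  ultimately obtain W where "W \<in> between T A j" "W \<inter> vec.span {x} = T \<inter> vec.span {x}"
    using avoid_subspace[OF A T vec.subspace_span sub j(1)] j(2) by force
  then show thesis using that[of W] Int vec.span_base[of x "{x}"] x0 by blast
qed

text \<open>A set of hyperplanes closed under pencils corresponds to a subspace of the dual space.
  Instead of combining functionals, the members of \<open>Y\<close> are added one at a time, and a
  hyperplane above the smaller intersection is reached through a single pencil.\<close>

lemma pencil_closed:
  fixes A :: "('a::{field,finite}^'n::finite) set"
  assumes A: "vec.subspace A" "vec.dim A = Suc h"
    and Z: "Z \<subseteq> between {0} A h"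
    and pencil: "\<And>H1 H2 H. H1 \<in> Z \<Longrightarrow> H2 \<in> Z \<Longrightarrow> H1 \<noteq> H2 \<Longrightarrow> H \<in> between {0} A h \<Longrightarrow> H1 \<inter> H2 \<subseteq> H \<Longrightarrow> H \<in> Z"
    and Y: "finite Y" "Y \<noteq> {}" "Y \<subseteq> Z" and H: "H \<in> between {0} A h" "\<Inter>Y \<subseteq> H"
  shows "H \<in> Z"
  using Y H
proof (induction Y arbitrary: H rule: finite_ne_induct)
  case (singleton x)
  then have "x \<in> between {0} A h" "x \<subseteq> H" using Z by auto
  then have "x = H" using singleton.prems(2) by (intro subspace_eqI) (simp_all add: between_def)
  then show ?case using singleton.prems by simp
next
  case (insert Hk Y)
  let ?W = "\<Inter>Y"
  have HkX: "Hk \<in> Z" and YX: "Y \<subseteq> Z" using insert.prems by auto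
  then have Hk: "Hk \<in> between {0} A h" using Z by blast
  note Hk' = betweenD[OF Hk] and H' = betweenD[OF insert.prems(2)]
  have W: "vec.subspace ?W" using YX Z by (intro vec.subspace_Inter) (auto simp: between_def)
  have WA: "?W \<subseteq> A"
  proof -
    obtain H' where "H' \<in> Y" using insert.hyps(2) by blast
    then show ?thesis using YX Z betweenD(3)[of H' "{0}" A h] by blast
  qed
  have WH: "?W \<inter> Hk \<subseteq> H" using insert.prems(3) by auto
  consider "?W \<subseteq> H" | "?W \<subseteq> Hk" | "H = Hk" | "\<not> ?W \<subseteq> H" "\<not> ?W \<subseteq> Hk" "H \<noteq> Hk" by blast
  then show ?case
  proof cases
    case 1
    then show ?thesis using insert.IH[OF YX insert.prems(2)] by simp
  next
    case 2
    then have "?W \<subseteq> H" using WH by blast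
    then show ?thesis using insert.IH[OF YX insert.prems(2)] by simp
  next
    case 3
    then show ?thesis using HkX by simp
  next
    case 4
    let ?M = "H \<inter> Hk"
    have M: "vec.subspace ?M" using H' Hk' by (intro vec.subspace_inter)
    have nH: "\<not> H \<subseteq> Hk" using subspace_eqI[OF H'(1) Hk'(1)] H' Hk' 4(3) by auto
    have dM: "h = Suc (vec.dim ?M)"
      using hyperplane_Int(1)[OF A(1) Hk'(1,3) _ H'(1,3) nH] A Hk' H' by simp
    have dW: "vec.dim ?W = Suc (vec.dim (?W \<inter> Hk))"
      using hyperplane_Int(1)[OF A(1) Hk'(1,3) _ W WA 4(2)] A Hk' by simp
    have e: "?W \<inter> ?M = ?W \<inter> Hk" using WH by blast
    \<comment> \<open>\<open>H1\<close> contains \<open>\<Inter>Y\<close>, so the induction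
      hypothesis puts it into \<open>Z\<close>. It meets \<open>Hk\<close> in
      \<open>H \<inter> Hk\<close>, so \<open>H\<close> belongs to the pencil of \<open>H1\<close>
      and \<open>Hk\<close>.\<close>
    define H1 where "H1 = vec.span (?W \<union> ?M)"
    have dH1: "vec.dim H1 = h"
      using dim_join[OF W M] dM dW unfolding e H1_def by simp
    have "?W \<union> ?M \<subseteq> H1" unfolding H1_def by (rule vec.span_superset)
    then have sub: "?W \<subseteq> H1" "?M \<subseteq> H1" by (simp_all only: Un_subset_iff)
    have H1: "H1 \<in> between {0} A h"
    proof (rule betweenI)
      show "vec.subspace H1" by (simp add: H1_def)
      then show "{0} \<subseteq> H1" by (simp add: vec.subspace_0)
      show "H1 \<subseteq> A" unfolding H1_def using WA H' A by (intro vec.span_minimal) auto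
    qed fact
    note H1' = betweenD[OF H1]
    have H1X: "H1 \<in> Z" using insert.IH[OF YX H1] sub by simp
    have ne: "H1 \<noteq> Hk" using sub 4(2) by blast
    have nH1: "\<not> H1 \<subseteq> Hk" using subspace_eqI[OF H1'(1) Hk'(1)] H1' Hk' ne by auto
    have "h = Suc (vec.dim (H1 \<inter> Hk))"
      using hyperplane_Int(1)[OF A(1) Hk'(1,3) _ H1'(1,3) nH1] A Hk' H1' by simp
    then have "?M = H1 \<inter> Hk"
      using sub dM by (intro subspace_eqI[OF M vec.subspace_inter[OF H1'(1) Hk'(1)]]) auto
    then have "H1 \<inter> Hk \<subseteq> H" by blast
    then show ?thesis using pencil[OF H1X HkX ne insert.prems(2)] by simp
  qed
qed

lemma qint_inject: "q \<ge> 2 \<Longrightarrow> qint q m = qint q n \<Longrightarrow> m = n"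
proof -
  assume q: "q \<ge> 2" and eq: "qint q m = qint q n"
  have "real q ^ m = real q ^ n" using qint_mult[of q m] qint_mult[of q n] eq by simp
  then show "m = n" using q by (simp add: power_inject_exp)
qed

text \<open>The hyperplanes containing a member of \<open>G\<close> are closed under pencils, hence
  they are all the hyperplanes above their intersection \<open>R\<close>. Counting them shows that
  \<open>R\<close> is a line; every member of \<open>G\<close> contains \<open>R\<close>, and the
  cardinality makes \<open>G\<close> the whole star.\<close>

lemma full_below_tight_star:
  fixes A :: "('a::{field,finite}^'n::finite) set"
  assumes A: "vec.subspace A" "vec.dim A = Suc (s + r)"
    and G: "G \<subseteq> between {0} A (Suc s)"
    and r: "r \<ge> 1" and s: "s \<ge> 1"
    and cG: "real (card G) \<le> gauss CARD('a) (s + r) r" and ne: "G \<noteq> {}"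
    and t: "real (card (full_below A s G)) * (real CARD('a) ^ Suc r - 1)
      = real (card G) * (real CARD('a) ^ s - 1)"
  shows "\<exists>R. vec.subspace R \<and> vec.dim R = 1 \<and> R \<subseteq> A \<and> G = between R A (Suc s)"
proof -
  let ?a = "s + r" and ?q = "real CARD('a)"
  let ?L = "between {0} A ?a"
  have q: "CARD('a) \<ge> 2" by (rule card_field_ge_2)
  have ra: "r \<le> ?a" by simp
  have t': "real (card (full_below A s G)) * (?q ^ Suc r - 1) = real (card G) * (?q ^ (?a - r) - 1)"
    using t by simp
  note T = full_below_tight[OF A G r ra cG ne t']
  define Z where "Z = {H \<in> ?L. {T \<in> G. T \<subseteq> H} \<noteq> {}}"
  have XL: "Z \<subseteq> ?L" by (auto simp: Z_def)
  have d: "real (card {T \<in> G. T \<subseteq> H}) * (?q ^ ?a - 1) = real (card G) * (?q ^ r - 1)"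
    and c: "CARD('a) ^ r * card {S \<in> full_below A s G. S \<subseteq> H} + card {T \<in> G. T \<subseteq> H} = card G"
    if "H \<in> Z" for H
    using T that by (auto simp: Z_def)
  have pencil: "H \<in> Z" if H: "H1 \<in> Z" "H2 \<in> Z" "H1 \<noteq> H2" "H \<in> ?L" "H1 \<inter> H2 \<subseteq> H" for H1 H2 H
  proof -
    note H' = betweenD[OF H(4)]
    obtain T1 where T1: "T1 \<in> G" "T1 \<subseteq> H1" using H(1) by (auto simp: Z_def)
    show ?thesis
    proof (cases "T1 \<subseteq> H2")
      case True
      then have "T1 \<subseteq> H" using T1 H by blast
      then show ?thesis using T1 H by (auto simp: Z_def)
    next
      case False
      \<comment> \<open>Tightness at \<open>H2\<close> makes this trace full. It lies in
        \<open>H1 \<inter> H2\<close> and so in \<open>H\<close>, and any of its covers inside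
        \<open>H\<close> is a member of \<open>G\<close>.\<close>
      have "T1 \<inter> H2 \<in> full_below A s G"
        by (rule full_below_hyperplane_le(2)[OF A _ G c[OF H(2)] T1(1) False]) (use H(2) XL in blast)
      then have S: "T1 \<inter> H2 \<in> between {0} A s" "between (T1 \<inter> H2) A (Suc s) \<subseteq> G"
        by (simp_all add: full_below_def)
      have SH: "T1 \<inter> H2 \<subseteq> H" using T1 H by blast
      obtain U where U: "U \<in> between (T1 \<inter> H2) H (Suc s)"
        using between_nonempty[OF betweenD(1)[OF S(1)] H'(1) SH, of "Suc s"] betweenD(4)[OF S(1)] H'(4) r by auto
      have "U \<in> G" using S(2) between_mono[OF subset_refl H'(3)] U by blast
      then show ?thesis using H(4) betweenD(3)[OF U] by (auto simp: Z_def)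
    qed
  qed
  obtain T0 where T0: "T0 \<in> G" using ne by blast
  have hyp_above: "H \<in> Z" if T: "T \<in> G" and H: "H \<in> between T A ?a" for T H
  proof -
    have "H \<in> ?L" using betweenD[OF H] by (intro betweenI) (simp_all add: vec.subspace_0)
    then show ?thesis using T betweenD(2)[OF H] by (auto simp: Z_def)
  qed
  have GA: "vec.subspace T" "T \<subseteq> A" "vec.dim T = Suc s" if "T \<in> G" for T
    using that G by (auto simp: between_def)
  obtain H0 where H0: "H0 \<in> between T0 A ?a"
    using between_nonempty[OF GA(1)[OF T0] A(1) GA(2)[OF T0], of ?a] GA(3)[OF T0] A r by auto
  have H0X: "H0 \<in> Z" by (rule hyp_above[OF T0 H0])
  define R where "R = \<Inter>Z"
  have R: "vec.subspace R" unfolding R_def using XL by (intro vec.subspace_Inter) (auto simp: between_def)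
  have RH0: "R \<subseteq> H0" unfolding R_def using H0X by blast
  have RA: "R \<subseteq> A" using RH0 betweenD(3)[OF H0] by blast
  have dR: "vec.dim R \<le> ?a" using vec.dim_subset[OF RH0] betweenD(4)[OF H0] by simp
  have XR: "Z = between R A (vec.dim A - 1)"
  proof (intro subset_antisym subsetI)
    fix H assume HX: "H \<in> Z"
    then have HL: "H \<in> ?L" using XL by blast
    have "R \<subseteq> H" unfolding R_def using HX by (rule Inter_lower)
    then show "H \<in> between R A (vec.dim A - 1)"
      using betweenD[OF HL] A by (intro betweenI) simp_all
  next
    fix H assume H: "H \<in> between R A (vec.dim A - 1)"
    have HL: "H \<in> ?L" using betweenD[OF H] A by (intro betweenI) (simp_all add: vec.subspace_0)
    have le: "\<Inter>Z \<subseteq> H" using betweenD(2)[OF H] by (simp only: R_def)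
    have ne: "Z \<noteq> {}" using H0X by blast
    show "H \<in> Z"
      by (rule pencil_closed[OF A XL _ finite ne subset_refl HL le], rule pencil)
  qed
  have cX: "card Z = qint CARD('a) (vec.dim A - vec.dim R)"
    unfolding XR using dR A by (intro card_hyperplanes_above[OF R A(1) RA]) auto
  \<comment> \<open>Incidences between \<open>G\<close> and the hyperplanes are counted twice. Each
    \<open>H \<in> Z\<close> contains exactly the star fraction of \<open>G\<close>, which gives
    \<open>card Z = qint q (s + r)\<close> and hence dimension one for \<open>R\<close>.\<close>
  have "(\<Sum>H\<in>?L. card {T \<in> G. T \<subseteq> H}) = (\<Sum>H\<in>Z. card {T \<in> G. T \<subseteq> H})"
    by (rule sum.mono_neutral_right) (auto simp: Z_def)
  then have "(\<Sum>H\<in>Z. card {T \<in> G. T \<subseteq> H}) = card G * qint CARD('a) r"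
    using sum_hyperplanes[OF A G, of r] r by simp
  then have "(\<Sum>H\<in>Z. real (card {T \<in> G. T \<subseteq> H})) = real (card G * qint CARD('a) r)"
    by (simp only: of_nat_sum[symmetric])
  then have "(\<Sum>H\<in>Z. real (card {T \<in> G. T \<subseteq> H}) * (?q ^ ?a - 1)) = real (card G * qint CARD('a) r) * (?q ^ ?a - 1)"
    by (simp only: sum_distrib_right[symmetric])
  then have "real (card Z) * (real (card G) * (?q ^ r - 1)) = real (card G) * qint CARD('a) r * (?q ^ ?a - 1)"
    by (simp add: d)
  then have "real (card G) * (real (card Z) * (?q ^ r - 1)) = real (card G) * (qint CARD('a) r * (?q ^ ?a - 1))"
    by (simp only: mult_ac)
  then have "real (card Z) * (?q ^ r - 1) = qint CARD('a) r * (?q ^ ?a - 1)"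
    using ne by simp
  then have "real (card Z) * (qint CARD('a) r * (?q - 1)) = qint CARD('a) r * (qint CARD('a) ?a * (?q - 1))"
    by (simp only: qint_mult)
  then have "(qint CARD('a) r * (?q - 1)) * real (card Z) = (qint CARD('a) r * (?q - 1)) * qint CARD('a) ?a"
    by (simp only: mult_ac)
  moreover have "qint CARD('a) r * (?q - 1) \<noteq> 0"
    using q_power_gt_1[OF q, of r] r unfolding qint_mult by simp
  ultimately have "card Z = qint CARD('a) ?a" by (simp only: mult_cancel_left of_nat_eq_iff) simp
  then have "vec.dim A - vec.dim R = ?a" using qint_inject[OF q] cX by simp
  then have R1: "vec.dim R = 1" using A dR r by simp
  \<comment> \<open>If \<open>T\<close> missed a point of \<open>R\<close>, a hyperplane above
    \<open>T\<close> could miss it as well; but that hyperplane is in \<open>Z\<close>, so it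
    contains \<open>R\<close>.\<close>
  have RT: "R \<subseteq> T" if TG: "T \<in> G" for T
  proof (rule ccontr)
    assume "\<not> R \<subseteq> T"
    then obtain x where x: "x \<in> R" "x \<notin> T" by blast
    obtain W where W: "W \<in> between T A ?a" "x \<notin> W"
      using avoid_point[OF A(1) GA(1,2)[OF TG] _ x(2), of ?a] x RA GA(3)[OF TG] A r by auto
    have "W \<in> Z" by (rule hyp_above[OF TG W(1)])
    then show False using x W by (auto simp: R_def)
  qed
  have sub: "G \<subseteq> between R A (Suc s)"
  proof
    fix T assume "T \<in> G"
    then show "T \<in> between R A (Suc s)" by (intro betweenI RT GA)
  qed
  have "real (card (between R A (Suc s))) = gauss CARD('a) ?a s"
    using card_between[OF R A(1) RA, of "Suc s"] R1 A s by simp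
  also have "\<dots> = gauss CARD('a) ?a r" using gauss_symmetric[OF q, of r ?a] by simp
  also have "\<dots> = real (card G)" using T by simp
  finally have "G = between R A (Suc s)" using sub by (intro card_subset_eq) simp_all
  then show ?thesis using R R1 RA by blast
qed

section \<open>Lower bounds for upper shadows\<close>

definition up_shadow :: "('a::field^'n::finite) set \<Rightarrow> nat \<Rightarrow> ('a^'n) set set \<Rightarrow> ('a^'n) set set" where
  "up_shadow A j F = {T \<in> between {0} A j. \<exists>S\<in>F. S \<subseteq> T}"

lemma subset_full_below_up_shadow:
  "F \<subseteq> between {0} A i \<Longrightarrow> F \<subseteq> full_below A i (up_shadow A (Suc i) F)"
  by (auto simp: full_below_def up_shadow_def between_def vec.subspace_0)

text \<open>The ratio \<open>c_(i+1) / c_i\<close> with denominators cleared, where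
  \<open>c_i = gauss q (n - 1) (i - 1)\<close> is the size of a star at level
  \<open>i\<close>.\<close>

lemma gauss_star_Suc:
  assumes "q \<ge> 2" "1 \<le> i" "i < n"
  shows "gauss q (n - 1) i * (real q ^ i - 1) = gauss q (n - 1) (i - 1) * (real q ^ (n - i) - 1)"
  using gauss_Suc_right[of q "i - 1" "n - 1"] assms by (simp del: power_Suc)

text \<open>A smaller shadow would have at most \<open>c_(i+1)\<close> members, so
  \<open>card_full_below_le\<close> applies to it and bounds the number of full subspaces, among
  which are all members of \<open>F\<close>.\<close>

lemma up_shadow_bound:
  fixes A :: "('a::{field,finite}^'n::finite) set"
  assumes A: "vec.subspace A" "vec.dim A = n" and i: "1 \<le> i" "i + 2 \<le> n"
    and F: "F \<subseteq> between {0} A i" "real (card F) \<le> gauss CARD('a) (n - 1) (i - 1)"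
  shows "real (card F) * (real CARD('a) ^ (n - i) - 1) \<le> real (card (up_shadow A (Suc i) F)) * (real CARD('a) ^ i - 1)"
proof (rule ccontr)
  let ?q = "real CARD('a)" and ?U = "up_shadow A (Suc i) F"
  assume n: "\<not> ?thesis"
  have q: "CARD('a) \<ge> 2" by (rule card_field_ge_2)
  have qi: "?q ^ i > 1" "?q ^ (n - i) > 1" using q_power_gt_1[OF q] i by simp_all
  define r where "r = n - Suc i"
  have r: "n = Suc (i + r)" "r \<ge> 1" using i by (simp_all add: r_def)
  have U: "?U \<subseteq> between {0} A (Suc i)" by (auto simp: up_shadow_def)
  have "real (card ?U) * (?q ^ i - 1) \<le> real (card F) * (?q ^ (n - i) - 1)" using n by simp
  also have "\<dots> \<le> gauss CARD('a) (n - 1) (i - 1) * (?q ^ (n - i) - 1)"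
    using F qi by (intro mult_right_mono) auto
  also have "\<dots> = gauss CARD('a) (n - 1) i * (?q ^ i - 1)"
    using gauss_star_Suc[OF q, of i n] i by simp
  finally have "real (card ?U) \<le> gauss CARD('a) (i + r) i" using qi r by simp
  also have "\<dots> = gauss CARD('a) (i + r) r" using gauss_symmetric[OF q, of r "i + r"] by simp
  finally have cU: "real (card ?U) \<le> gauss CARD('a) (i + r) r" .
  have "real (card (full_below A i ?U)) * (?q ^ Suc r - 1) \<le> real (card ?U) * (?q ^ (i + r - r) - 1)"
    using A r cU U by (intro card_full_below_le) simp_all
  moreover have "real (card F) * (?q ^ Suc r - 1) \<le> real (card (full_below A i ?U)) * (?q ^ Suc r - 1)"
    using subset_full_below_up_shadow[OF F(1)] q_power_gt_1[OF q, of "Suc r"]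
    by (intro mult_right_mono) (auto intro!: card_mono simp del: power_Suc)
  ultimately show False using n r by simp
qed

text \<open>The shadow has exactly \<open>c_(i+1)\<close> members and attains the bound on full
  subspaces, so it is a star by \<open>full_below_tight_star\<close>. A member of \<open>F\<close>
  not containing the centre would have a cover not containing it either.\<close>

lemma up_shadow_star:
  fixes A :: "('a::{field,finite}^'n::finite) set"
  assumes A: "vec.subspace A" "vec.dim A = n" and i: "1 \<le> i" "i + 2 \<le> n"
    and F: "F \<subseteq> between {0} A i" "real (card F) = gauss CARD('a) (n - 1) (i - 1)"
    and U: "real (card (up_shadow A (Suc i) F)) \<le> gauss CARD('a) (n - 1) i"
  shows "\<exists>R. vec.subspace R \<and> vec.dim R = 1 \<and> R \<subseteq> A \<and> F = between R A i"
proof -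
  let ?q = "real CARD('a)" and ?U = "up_shadow A (Suc i) F"
  have q: "CARD('a) \<ge> 2" by (rule card_field_ge_2)
  have qi: "?q ^ i > 1" "?q ^ (n - i) > 1" using q_power_gt_1[OF q] i by simp_all
  define r where "r = n - Suc i"
  have r: "n = Suc (i + r)" "r \<ge> 1" using i by (simp_all add: r_def)
  have UL: "?U \<subseteq> between {0} A (Suc i)" by (auto simp: up_shadow_def)
  note star = gauss_star_Suc[OF q, of i n]
  have sym: "gauss CARD('a) (i + r) i = gauss CARD('a) (i + r) r" using gauss_symmetric[OF q, of r "i + r"] by simp
  have "gauss CARD('a) (n - 1) i * (?q ^ i - 1) \<le> real (card ?U) * (?q ^ i - 1)"
    using up_shadow_bound[OF A i F(1)] F(2) star i by simp
  then have cU: "real (card ?U) = gauss CARD('a) (n - 1) i" using U qi by simp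
  then have cU': "real (card ?U) = gauss CARD('a) (i + r) r" using r sym by simp
  have "real (card (full_below A i ?U)) * (?q ^ Suc r - 1) \<le> real (card ?U) * (?q ^ (i + r - r) - 1)"
    using A r cU' UL by (intro card_full_below_le) simp_all
  moreover have FK: "real (card F) * (?q ^ Suc r - 1) \<le> real (card (full_below A i ?U)) * (?q ^ Suc r - 1)"
    using subset_full_below_up_shadow[OF F(1)] q_power_gt_1[OF q, of "Suc r"]
    by (intro mult_right_mono) (auto intro!: card_mono simp del: power_Suc)
  moreover have "real (card F) * (?q ^ Suc r - 1) = real (card ?U) * (?q ^ i - 1)"
    using star cU F(2) i r by simp
  ultimately have t: "real (card (full_below A i ?U)) * (?q ^ Suc r - 1) = real (card ?U) * (?q ^ i - 1)"
    by simp
  have "i \<le> n - 1" using i by simp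
  then have "real (card ?U) > 0" using cU gauss_pos[OF q] by simp
  then have "?U \<noteq> {}" by auto
  then obtain R where R: "vec.subspace R" "vec.dim R = 1" "R \<subseteq> A" "?U = between R A (Suc i)"
    using full_below_tight_star[OF A(1) _ UL r(2) i(1) _ _ t] A r cU' by auto
  have "R \<subseteq> S" if S: "S \<in> F" for S
  proof (rule ccontr)
    assume "\<not> R \<subseteq> S"
    then obtain x where x: "x \<in> R" "x \<notin> S" by blast
    have SL: "S \<in> between {0} A i" using S F by blast
    note S' = betweenD[OF SL]
    obtain W where W: "W \<in> between S A (Suc i)" "x \<notin> W"
      using avoid_point[OF A(1) S'(1,3) _ x(2), of "Suc i"] x R S' A i by auto
    have "W \<in> between {0} A (Suc i)"
      using betweenD[OF W(1)] by (intro betweenI) (simp_all add: vec.subspace_0)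
    then have "W \<in> ?U" using S betweenD(2)[OF W(1)] by (auto simp: up_shadow_def)
    then show False using R x W by (auto simp: between_def)
  qed
  then have "F \<subseteq> between R A i" using F(1) by (auto simp: between_def)
  moreover have "real (card (between R A i)) = real (card F)"
    using card_between[OF R(1) A(1) R(3), of i] R A i F(2) by simp
  ultimately have "F = between R A i" by (intro card_subset_eq) simp_all
  then show ?thesis using R by blast
qed

section \<open>Spreads\<close>

text \<open>Both sides differ by a polynomial in \<open>x\<close> of degree below \<open>Q\<close> with \<open>Q\<close> roots; using this twice makes
  the \<open>q\<close>-power map additive on the closure without knowing that \<open>q\<close> is a power of the characteristic.\<close>

lemma power_add_extend:
  fixes b :: "'a::idom" and S :: "'a set"
  assumes S: "finite S" "card S \<ge> Q" "Q > 0" and eq: "\<And>a. a \<in> S \<Longrightarrow> (a + b) ^ Q = a ^ Q + b ^ Q"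
  shows "(x + b) ^ Q = x ^ Q + b ^ Q"
proof -
  define p where "p = [:b, 1:] ^ Q - (monom 1 Q + [:b ^ Q:])"
  have ev: "poly p x = (x + b) ^ Q - (x ^ Q + b ^ Q)" for x
    by (simp add: p_def poly_monom add_ac)
  have "p = 0"
  proof (rule ccontr)
    assume "p \<noteq> 0"
    have d1: "degree ([:b, 1:] ^ Q) = Q" by (simp add: degree_power_eq)
    have d2: "degree (monom 1 Q + [:b ^ Q:]) = Q"
      using S by (subst degree_add_eq_left) (simp_all add: degree_monom_eq)
    have "coeff ([:b, 1:] ^ Q) Q = 1"
      using lead_coeff_power[of "[:b, 1:]" Q] d1 by simp
    moreover have "coeff (monom 1 Q + [:b ^ Q:]) Q = 1"
      using S by (cases Q) (simp_all)
    ultimately have "coeff p Q = 0" by (simp add: p_def)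
    moreover have "degree p \<le> Q" unfolding p_def using d1 d2 by (intro degree_diff_le) auto
    ultimately have "degree p < Q" using \<open>p \<noteq> 0\<close> by (metis le_neq_implies_less leading_coeff_0_iff)
    moreover have "card S \<le> card {x. poly p x = 0}"
      using eq by (intro card_mono poly_roots_finite \<open>p \<noteq> 0\<close>) (auto simp: ev)
    moreover have "card {x. poly p x = 0} \<le> degree p" by (rule card_poly_roots_bound) fact
    ultimately show False using S by linarith
  qed
  then show ?thesis using ev[of x] by simp
qed

lemma field_power_card:
  fixes x :: "'a::{field,finite}"
  shows "x ^ CARD('a) = x"
proof (cases "x = 0")
  case False
  have "(\<Prod>y\<in>UNIV-{0}. x * y) = (\<Prod>y\<in>UNIV-{0}. y)"
    by (rule prod.reindex_bij_witness[of _ "\<lambda>y. y / x" "\<lambda>y. x * y"]) (use False in auto)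
  moreover have "(\<Prod>y\<in>UNIV-{0}. x * y) = x ^ (CARD('a) - 1) * (\<Prod>y\<in>UNIV-{0}. y)"
    by (simp add: prod.distrib)
  moreover have "(\<Prod>y\<in>UNIV-{0::'a}. y) \<noteq> 0" by (simp add: prod_zero_iff)
  ultimately have "x ^ (CARD('a) - 1) = 1" by simp
  then have "x ^ Suc (CARD('a) - 1) = x" by (simp only: power_Suc mult_1_right)
  then show ?thesis by simp
qed simp

lemma field_power_card_power: "(x :: 'a::{field,finite}) ^ (CARD('a) ^ m) = x"
  by (induction m) (simp_all add: power_mult field_power_card)

text \<open>Translation by one permutes the field, so adding \<open>CARD('a)\<close> times one to
  the sum of all elements does not change it.\<close>

lemma of_nat_card_field: "of_nat CARD('a) = (0 :: 'a::{field,finite})"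
proof -
  have "(\<Sum>x\<in>UNIV. x + 1) = (\<Sum>x\<in>(UNIV :: 'a set). x)"
    by (rule sum.reindex_bij_witness[of _ "\<lambda>y. y - 1" "\<lambda>y. y + 1"]) auto
  then show ?thesis by (simp add: sum.distrib)
qed

lemma alg_closure_power_add:
  fixes x y :: "'a::{field,finite} alg_closure"
  shows "(x + y) ^ (CARD('a) ^ m) = x ^ (CARD('a) ^ m) + y ^ (CARD('a) ^ m)"
proof -
  let ?S = "range (to_ac :: 'a \<Rightarrow> _)" and ?Q = "CARD('a)"
  have cS: "finite ?S" "card ?S \<ge> ?Q" "?Q > 0" by (simp_all add: card_image[OF inj_to_ac])
  have 0: "(a + b) ^ ?Q = a ^ ?Q + b ^ ?Q" if "a \<in> ?S" "b \<in> ?S" for a b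
  proof -
    obtain c d where cd: "a = to_ac c" "b = to_ac d" using \<open>a \<in> ?S\<close> \<open>b \<in> ?S\<close> by blast
    show ?thesis unfolding cd to_ac_add[symmetric] to_ac_power[symmetric] field_power_card ..
  qed
  have 1: "(x + b) ^ ?Q = x ^ ?Q + b ^ ?Q" if "b \<in> ?S" for x b :: "'a alg_closure"
    by (rule power_add_extend[OF cS 0]) (use that in auto)
  have 2: "(x + y) ^ ?Q = x ^ ?Q + y ^ ?Q" for x y :: "'a alg_closure"
  proof (rule power_add_extend[OF cS])
    fix a assume "a \<in> ?S"
    then show "(a + y) ^ ?Q = a ^ ?Q + y ^ ?Q" using 1[of a y] by (simp add: add.commute)
  qed
  show ?thesis
  proof (induction m)
    case (Suc m)
    show ?case using Suc by (simp only: power_Suc2 power_mult 2)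
  qed simp
qed

text \<open>Over the closure \<open>x^N - x\<close> splits, and its derivative is \<open>-1\<close>
  because \<open>N\<close> is zero there. So all roots are simple and there are \<open>N\<close> of
  them.\<close>

lemma card_roots_power_card:
  assumes m: "m \<ge> 1"
  shows "card {x :: 'a::{field,finite} alg_closure. x ^ (CARD('a) ^ m) = x} = CARD('a) ^ m"
proof -
  let ?N = "CARD('a) ^ m"
  define p :: "'a alg_closure poly" where "p = monom 1 ?N - monom 1 1"
  have N: "?N \<ge> 2"
    using card_field_ge_2[where 'a='a] m self_le_power[of "CARD('a)" m] by simp
  have ev: "poly p x = x ^ ?N - x" for x by (simp add: p_def poly_monom)
  have deg: "degree p = ?N"
    unfolding p_def diff_conv_add_uminus using N by (subst degree_add_eq_left) (simp_all add: degree_monom_eq)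
  have p0: "p \<noteq> 0" using deg N by auto
  have lc: "lead_coeff p = 1" unfolding deg using N by (simp add: p_def)
  obtain A where A: "size A = degree p" "p = (\<Prod>x\<in>#A. [:-x, 1:])"
    using alg_closed_imp_factorization[OF p0] lc by auto
  have "to_ac (of_nat CARD('a) :: 'a) = 0" by (simp only: of_nat_card_field to_ac_0)
  then have Q0: "of_nat CARD('a) = (0 :: 'a alg_closure)" by (simp only: to_ac_of_nat)
  have N0: "of_nat ?N = (0 :: 'a alg_closure)"
    using m by (simp only: of_nat_power Q0) simp
  have pd: "poly (pderiv p) x = - 1" for x
    unfolding p_def pderiv_diff pderiv_monom N0 by simp
  have cnt: "count A x \<le> 1" for x
  proof (rule ccontr)
    assume "\<not> count A x \<le> 1"
    then have "{#x, x#} \<subseteq># A" by (simp add: subseteq_mset_def)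
    then obtain B where "A = {#x, x#} + B" by (meson mset_subset_eq_exists_conv)
    define u where "u = [:-x, 1:]"
    have u: "poly u x = 0" by (simp add: u_def)
    have "p = u * (u * (\<Prod>x\<in>#B. [:-x, 1:]))"
      unfolding A(2) \<open>A = {#x, x#} + B\<close> u_def by (simp del: mult_pCons_left mult_pCons_right)
    then have "poly (pderiv p) x = 0" by (simp add: pderiv_mult u)
    then show False using pd by simp
  qed
  have "count A x = 1" if "x \<in># A" for x
    using cnt[of x] that by (simp add: Suc_le_eq le_antisym)
  then have "card (set_mset A) = size A"
    by (simp add: size_multiset_overloaded_eq)
  moreover have "set_mset A = {x. x ^ ?N = x}"
  proof (rule Set.set_eqI)
    fix x
    have "x ^ ?N = x \<longleftrightarrow> poly p x = 0" by (simp add: ev)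
    also have "\<dots> \<longleftrightarrow> x \<in># A" unfolding A(2) by (auto simp: poly_prod_mset prod_mset_zero_iff)
    finally show "x \<in> set_mset A \<longleftrightarrow> x \<in> {x. x ^ ?N = x}" by simp
  qed
  ultimately show ?thesis using A(1) deg by simp
qed

text \<open>The spread consists of the lines through the origin of \<open>K\<^sup>2\<close>, where \<open>K\<close> is the extension of
  degree \<open>m\<close> of the ground field.\<close>

lemma spread_exists:
  assumes n: "CARD('n::finite) = 2 * m" and m: "m \<ge> 1"
  obtains \<S> :: "('a::{field,finite}^'n) set set" where
    "\<S> \<subseteq> between {0} UNIV m" "card \<S> = CARD('a) ^ m + 1" "pairwise (\<lambda>S T. S \<inter> T = {0}) \<S>"
proof -
  let ?N = "CARD('a) ^ m"
  define K :: "'a alg_closure set" where "K = {x. x ^ ?N = x}"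
  have cK: "card K = ?N" unfolding K_def by (rule card_roots_power_card[OF m])
  have N2: "?N \<ge> 2"
    using card_field_ge_2[where 'a='a] m self_le_power[of "CARD('a)" m] by simp
  then have finK: "finite K" using cK card.infinite by fastforce
  have K0: "0 \<in> K" using N2 by (simp add: K_def)
  have Kadd: "x + y \<in> K" if "x \<in> K" "y \<in> K" for x y
    using that by (simp add: K_def alg_closure_power_add)
  have Kmult: "x * y \<in> K" if "x \<in> K" "y \<in> K" for x y
    using that by (simp add: K_def power_mult_distrib)
  have Kac: "to_ac a \<in> K" for a
    unfolding K_def using field_power_card_power[of a m] by (simp flip: to_ac_power)
  have Kuminus: "- x \<in> K" if "x \<in> K" for x using Kmult[OF Kac[of "-1"] that] by simp
  have Kdiff: "x - y \<in> K" if "x \<in> K" "y \<in> K" for x y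
    using Kadd[OF that(1) Kuminus[OF that(2)]] by simp
  interpret ac: vector_space "\<lambda>(a::'a) (x::'a alg_closure). to_ac a * x"
    by unfold_locales (simp_all add: algebra_simps)
  have Ksub: "ac.subspace K" by (simp add: ac.subspace_def K0 Kadd Kmult Kac)
  obtain B where B: "B \<subseteq> K" "ac.independent B" "K \<subseteq> ac.span B" "card B = ac.dim K"
    by (rule ac.basis_exists[of K])
  have finB: "finite B" using B(1) finK by (rule finite_subset)
  have "ac.span B = K" using B(1,3) Ksub by (rule ac.span_subspace)
  then have "?N = CARD('a) ^ card B"
    using ac.card_span_independent[OF _ finB B(2)] cK by simp
  then have cB: "card B = m" using card_field_ge_2[where 'a='a] by (simp add: power_inject_exp)
  obtain I :: "'n set" where I: "card I = m"
    using obtain_subset_with_card_n[of m "UNIV :: 'n set"] n by auto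
  have I': "card (- I) = m" using I n by (simp add: Compl_eq_Diff_UNIV card_Diff_subset)
  \<comment> \<open>Matching the indices in \<open>J\<close> with a basis of \<open>K\<close> makes
    the coordinate block \<open>J\<close> a copy of \<open>K\<close>. With the two halves of the
    index set, \<open>f\<close> and \<open>g\<close> together identify \<open>'a ^ 'n\<close> with
    \<open>K \<times> K\<close>.\<close>
  have coord: "\<exists>f :: 'a^'n \<Rightarrow> 'a alg_closure. (\<forall>v w. f (v + w) = f v + f w) \<and> (\<forall>c v. f (c *s v) = to_ac c * f v)
      \<and> range f \<subseteq> K \<and> (\<forall>v. f v = 0 \<longrightarrow> (\<forall>i\<in>J. v $ i = 0))" if J: "card J = m" for J :: "'n set"
  proof -
    obtain e where e: "bij_betw e J B"
      using finite_same_card_bij[of J B] finB J cB by auto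
    define f where "f v = (\<Sum>i\<in>J. to_ac (v $ i) * e i)" for v :: "'a^'n"
    have eK: "e i \<in> K" if "i \<in> J" for i using that e B(1) by (auto simp: bij_betw_def)
    have "f v \<in> K" for v
      unfolding f_def using eK by (intro ac.subspace_sum[OF Ksub] Kmult Kac)
    moreover have "v $ i = 0" if fv: "f v = 0" and i: "i \<in> J" for v :: "'a^'n" and i
    proof -
      let ?u = "\<lambda>b. v $ inv_into J e b"
      have "(\<Sum>b\<in>B. to_ac (?u b) * b) = (\<Sum>i\<in>J. to_ac (?u (e i)) * e i)"
        using sum.reindex_bij_betw[OF e, of "\<lambda>b. to_ac (?u b) * b"] by simp
      also have "\<dots> = f v"
        unfolding f_def using e by (intro sum.cong) (auto simp: bij_betw_def)
      finally have "?u (e i) = 0"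
        using ac.independentD[OF B(2) finB subset_refl, of ?u "e i"] fv e i by (auto simp: bij_betw_def)
      then show ?thesis using e i by (auto simp: bij_betw_def)
    qed
    moreover have "f (v + w) = f v + f w" for v w
      unfolding f_def by (simp add: distrib_right sum.distrib)
    moreover have "f (c *s v) = to_ac c * f v" for v c
      unfolding f_def sum_distrib_left
      by (intro sum.cong refl) (simp only: vector_smult_component to_ac_mult mult.assoc)
    ultimately show ?thesis by (intro exI[of _ f] conjI allI image_subsetI impI ballI)
  qed
  obtain f g :: "'a^'n \<Rightarrow> 'a alg_closure"
    where f: "\<And>v w. f (v + w) = f v + f w" "\<And>c v. f (c *s v) = to_ac c * f v" "\<And>v. f v \<in> K"
        "\<And>v i. f v = 0 \<Longrightarrow> i \<in> I \<Longrightarrow> v $ i = 0"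
      and g: "\<And>v w. g (v + w) = g v + g w" "\<And>c v. g (c *s v) = to_ac c * g v" "\<And>v. g v \<in> K"
        "\<And>v i. g v = 0 \<Longrightarrow> i \<notin> I \<Longrightarrow> v $ i = 0"
  proof -
    obtain f :: "'a^'n \<Rightarrow> 'a alg_closure" where "(\<forall>v w. f (v + w) = f v + f w) \<and> (\<forall>c v. f (c *s v) = to_ac c * f v)
      \<and> range f \<subseteq> K \<and> (\<forall>v. f v = 0 \<longrightarrow> (\<forall>i\<in>I. v $ i = 0))" using coord[OF I] by (elim exE)
    moreover obtain g :: "'a^'n \<Rightarrow> 'a alg_closure" where "(\<forall>v w. g (v + w) = g v + g w) \<and> (\<forall>c v. g (c *s v) = to_ac c * g v)
      \<and> range g \<subseteq> K \<and> (\<forall>v. g v = 0 \<longrightarrow> (\<forall>i\<in>-I. v $ i = 0))" using coord[OF I'] by (elim exE)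
    ultimately show thesis by (intro that[of f g]) (simp_all add: image_subset_iff)
  qed
  have fg: "v = 0" if "f v = 0" "g v = 0" for v
    using f(4)[OF that(1)] g(4)[OF that(2)] by (simp add: vec_eq_iff) blast
  \<comment> \<open>\<open>T c\<close> is the line of slope \<open>c\<close> through the origin of
    \<open>K \<times> K\<close>, and \<open>T'\<close> is the vertical line.\<close>
  define T where "T \<equiv> \<lambda>c. {v. g v = c * f v}"
  define T' where "T' = {v. f v = 0}"
  have f0: "f 0 = 0" and g0: "g 0 = 0" using f(2)[of 0 0] g(2)[of 0 0] by simp_all
  have subT: "vec.subspace (T c)" for c
    unfolding T_def vec.subspace_def by (auto simp: f g f0 g0 algebra_simps)
  have subT': "vec.subspace T'"
    unfolding T'_def vec.subspace_def by (auto simp: f f0)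
  have IntT: "T c \<inter> T d = {0}" if "c \<noteq> d" for c d
  proof -
    have "v = 0" if v: "v \<in> T c" "v \<in> T d" for v
    proof -
      have "c * f v = d * f v" using v by (simp add: T_def)
      then have "f v = 0" using \<open>c \<noteq> d\<close> by simp
      moreover have "g v = 0" using v \<open>f v = 0\<close> by (simp add: T_def)
      ultimately show ?thesis by (rule fg)
    qed
    then show ?thesis using subT vec.subspace_0 by blast
  qed
  have IntT': "T c \<inter> T' = {0}" for c
  proof -
    have "v = 0" if v: "v \<in> T c" "v \<in> T'" for v
      using v by (intro fg) (simp_all add: T_def T'_def)
    then show ?thesis using subT subT' vec.subspace_0 by blast
  qed
  \<comment> \<open>The fibres of \<open>h\<close> are empty or translates of its kernel
    \<open>U\<close>, and at most \<open>card K = q^m\<close> values occur, so \<open>U\<close> has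
    at least \<open>q^(2 * m) / q^m\<close> elements.\<close>
  have dim_ge: "m \<le> vec.dim U" if U: "vec.subspace U" "U = {v. h v = 0}"
      and h: "\<And>v w. h (v - w) = h v - h w" "\<And>v. h v \<in> K" for U and h :: "'a^'n \<Rightarrow> 'a alg_closure"
  proof -
    have fib: "card {v. h v = k} \<le> card U" for k
    proof (cases "\<exists>w. h w = k")
      case True
      then obtain w where "h w = k" by blast
      then have "(\<lambda>v. v - w) ` {v. h v = k} \<subseteq> U" by (auto simp: U(2) h(1))
      then show ?thesis by (intro card_inj_on_le[of "\<lambda>v. v - w"]) (auto simp: inj_on_def)
    next
      case False
      then have "{v. h v = k} = {}" by blast
      then show ?thesis by simp
    qed
    have "(UNIV :: ('a^'n) set) = (\<Union>k\<in>K. {v. h v = k})" using h(2) by blast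
    then have "CARD('a^'n) \<le> (\<Sum>k\<in>K. card {v. h v = k})"
      using card_UN_le[OF finK, of "\<lambda>k. {v. h v = k}"] by simp
    also have "\<dots> \<le> card K * card U" using sum_bounded_above[of K _ "card U"] fib by auto
    finally have "CARD('a^'n) \<le> card K * card U" .
    moreover have "CARD('a^'n) = CARD('a) ^ (2 * m)"
      using card_subspace[where 'a='a and 'n='n, OF vec.subspace_UNIV] by (simp only: vec_dim_card n)
    ultimately have "CARD('a) ^ (2 * m) \<le> ?N * CARD('a) ^ vec.dim U"
      by (simp only: cK card_subspace[OF U(1)])
    then have "CARD('a) ^ (2 * m) \<le> CARD('a) ^ (m + vec.dim U)" by (simp only: power_add)
    then have "2 * m \<le> m + vec.dim U" using card_field_ge_2[where 'a='a] by (simp add: power_increasing_iff)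
    then show ?thesis by simp
  qed
  have fd: "f (v - w) = f v - f w" "g (v - w) = g v - g w" for v w
    using f(1)[of "v - w" w] g(1)[of "v - w" w] by simp_all
  have dT: "m \<le> vec.dim (T c)" if "c \<in> K" for c
    by (rule dim_ge[OF subT, of _ "\<lambda>v. g v - c * f v"])
      (use that in \<open>auto simp: T_def fd algebra_simps intro!: Kdiff Kmult f g\<close>)
  have dT': "m \<le> vec.dim T'"
    by (rule dim_ge[OF subT', of f]) (auto simp: T'_def fd f)
  \<comment> \<open>Subspaces meeting in zero have dimensions adding up to at most
    \<open>2 * m\<close>; with the lower bounds all dimensions are exactly \<open>m\<close>.\<close>
  have le: "vec.dim U + vec.dim V \<le> 2 * m" if "vec.subspace U" "vec.subspace V" "U \<inter> V = {0}" for U V :: "('a^'n) set"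
    using dim_join[OF that(1,2)] dim_subset_UNIV_cart_gen[of "vec.span (U \<union> V)"] that(3) n by simp
  have "vec.dim T' = m" using dT' dT[OF K0] le[OF subT subT' IntT', of 0] by linarith
  moreover have "vec.dim (T c) = m" if "c \<in> K" for c
    using dT' dT[OF that] le[OF subT subT' IntT', of c] by linarith
  ultimately have lev: "insert T' (T ` K) \<subseteq> between {0} UNIV m"
    using subT subT' by (auto simp: between_def vec.subspace_0)
  have ne: "U \<noteq> {0}" if "U \<in> between {0} UNIV m" for U :: "('a^'n) set"
    using betweenD(4)[OF that] m by auto
  have "inj_on T K"
  proof (rule inj_onI, rule ccontr)
    fix c d assume "c \<in> K" "d \<in> K" "T c = T d" "c \<noteq> d"
    then show False using IntT[of c d] ne[of "T c"] lev by auto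
  qed
  moreover have "T' \<notin> T ` K"
  proof
    assume "T' \<in> T ` K"
    then obtain c where "T' = T c" by blast
    then show False using IntT'[of c] ne[of T'] lev by auto
  qed
  ultimately have "card (insert T' (T ` K)) = ?N + 1" using finK cK by (simp add: card_image)
  moreover have "pairwise (\<lambda>S T. S \<inter> T = {0}) (insert T' (T ` K))"
  proof (rule pairwiseI)
    fix S U assume "S \<in> insert T' (T ` K)" "U \<in> insert T' (T ` K)" "S \<noteq> U"
    then consider c where "S = T'" "U = T c" | c where "S = T c" "U = T'"
      | c d where "S = T c" "U = T d" "c \<noteq> d" by blast
    then show "S \<inter> U = {0}" by cases (simp_all add: IntT IntT' Int_commute[of T'])
  qed
  ultimately show thesis using that lev by blast
qed

section \<open>Intersecting families of subspaces of equal dimension\<close>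

lemma linear_automorphism_exists:
  fixes U U' :: "('a::field^'n::finite) set"
  assumes "vec.subspace U" "vec.subspace U'" "vec.dim U = vec.dim U'"
  obtains h where "Vector_Spaces.linear (*s) (*s) h" "inj h" "h ` U = U'"
proof -
  obtain B where B: "B \<subseteq> U" "vec.independent B" "U \<subseteq> vec.span B" "card B = vec.dim U"
    by (rule vec.basis_exists)
  obtain B' where B': "B' \<subseteq> U'" "vec.independent B'" "U' \<subseteq> vec.span B'" "card B' = vec.dim U'"
    by (rule vec.basis_exists)
  have sp: "vec.span B = U" "vec.span B' = U'"
    using B B' assms(1,2) vec.span_subspace by blast+
  obtain f where f: "bij_betw f B B'"
    using finite_same_card_bij[of B B'] vec.finiteI_independent[OF B(2)] vec.finiteI_independent[OF B'(2)] B B' assms(3) by auto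
  obtain h where h: "Vector_Spaces.linear (*s) (*s) h" "inj h" "\<forall>x\<in>B. h x = f x"
    using vec.linear_independent_extend_inj[OF B(2), of f] f B'(2) by (auto simp: bij_betw_def)
  interpret h: Vector_Spaces.linear "(*s)" "(*s)" h by fact
  have "h ` B = B'" using f h(3) by (auto simp: bij_betw_def)
  then have "h ` U = U'" using h.span_image[of B] sp by simp
  then show thesis using that h by blast
qed

lemma intersecting_familyD:
  "intersecting_family F \<Longrightarrow> V \<in> F \<Longrightarrow> W \<in> F \<Longrightarrow> V \<noteq> W \<Longrightarrow> vec.dim (V \<inter> W) > 0"
  unfolding intersecting_family_def pairwise_def by blast

text \<open>The members of a spread meet pairwise in zero, so any image of it under an invertible
  linear map has at most one member in \<open>F\<close>. The images of a fixed
  \<open>m\<close>-dimensional subspace are equidistributed over all of them, so \<open>F\<close>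
  contains at most the fraction \<open>1/(q^m + 1)\<close>.\<close>

lemma ekr_middle:
  fixes F :: "('a::{field,finite}^'n::finite) set set"
  assumes n: "CARD('n) = 2 * m" and m: "m \<ge> 1"
    and F: "F \<subseteq> between {0} UNIV m" "intersecting_family F"
  shows "real (card F) \<le> gauss CARD('a) (2 * m - 1) (m - 1)"
proof -
  let ?L = "between {0} UNIV m :: ('a^'n) set set" and ?q = "real CARD('a)"
  obtain \<S> :: "('a^'n) set set" where
    \<S>: "\<S> \<subseteq> ?L" "card \<S> = CARD('a) ^ m + 1" "pairwise (\<lambda>S T. S \<inter> T = {0}) \<S>"
    using spread_exists[OF n m] by blast
  define GL :: "('a^'n \<Rightarrow> 'a^'n) set" where "GL = {g. Vector_Spaces.linear (*s) (*s) g \<and> inj g}"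
  have img: "g ` S \<in> ?L" if "g \<in> GL" "S \<in> ?L" for g S
  proof -
    have g: "Vector_Spaces.linear (*s) (*s) g" "inj g" using that(1) by (simp_all add: GL_def)
    interpret g: Vector_Spaces.linear "(*s)" "(*s)" g by (rule g(1))
    note S = betweenD[OF that(2)]
    have "vec.subspace (g ` S)" using S(1) by (rule g.subspace_image)
    moreover have "vec.dim (g ` S) = vec.dim S"
      using g by (intro vec.dim_image_eq) (auto intro: inj_on_subset)
    ultimately show ?thesis using S by (intro betweenI) (simp_all add: vec.subspace_0)
  qed
  define N where "N \<equiv> \<lambda>S U. card {g \<in> GL. g ` S = U}"
  \<comment> \<open>Composition with an automorphism taking \<open>U\<close> to \<open>U'\<close>
    embeds one set of maps into the other. Exchanging \<open>U\<close> and \<open>U'\<close> turns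
    this into an equality, so \<open>N S U\<close> does not depend on \<open>U\<close>.\<close>
  have le: "N S U \<le> N S U'" if U: "U \<in> ?L" "U' \<in> ?L" for S U U'
  proof -
    obtain h where h: "Vector_Spaces.linear (*s) (*s) h" "inj h" "h ` U = U'"
      using linear_automorphism_exists[OF betweenD(1)[OF U(1)] betweenD(1)[OF U(2)]]
        betweenD(4)[OF U(1)] betweenD(4)[OF U(2)] by metis
    have "inj_on (\<lambda>g. h \<circ> g) {g \<in> GL. g ` S = U}"
      using h(2) by (auto simp: inj_on_def fun_eq_iff)
    moreover have "(\<lambda>g. h \<circ> g) ` {g \<in> GL. g ` S = U} \<subseteq> {g \<in> GL. g ` S = U'}"
    proof (intro image_subsetI CollectI conjI)
      fix g assume g: "g \<in> {g \<in> GL. g ` S = U}"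
      then show "h \<circ> g \<in> GL"
        using h Vector_Spaces.linear_compose[of "(*s)" "(*s)" g "(*s)" h] inj_compose[of h g] by (simp add: GL_def)
      show "(h \<circ> g) ` S = U'" using g h(3) by (auto simp: image_comp[symmetric])
    qed
    ultimately show ?thesis unfolding N_def by (intro card_inj_on_le) simp_all
  qed
  have tot: "N S U * card ?L = card GL" if "S \<in> ?L" "U \<in> ?L" for S U
  proof -
    have "card GL = (\<Sum>U'\<in>?L. N S U')"
      unfolding N_def using sum.group[of GL ?L "\<lambda>g. g ` S" "\<lambda>_. 1 :: nat"] img[OF _ that(1)]
      by (simp add: image_subset_iff)
    also have "\<dots> = (\<Sum>U'\<in>?L. N S U)"
      using le that(2) by (intro sum.cong refl le_antisym) auto
    finally show ?thesis by simp
  qed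
  have "(\<Sum>S\<in>\<S>. card {g \<in> GL. g ` S \<in> F}) = (\<Sum>g\<in>GL. card {S \<in> \<S>. g ` S \<in> F})"
    by (rule card_double_count) simp_all
  also have "\<dots> \<le> (\<Sum>g\<in>GL. 1)"
  proof (rule sum_mono)
    fix g assume "g \<in> GL"
    then have g: "Vector_Spaces.linear (*s) (*s) g" "inj g" by (simp_all add: GL_def)
    interpret g: Vector_Spaces.linear "(*s)" "(*s)" g by (rule g(1))
    have "S = T" if "S \<in> \<S>" "T \<in> \<S>" "g ` S \<in> F" "g ` T \<in> F" for S T
    proof (rule ccontr)
      assume ST: "S \<noteq> T"
      have "g ` S \<inter> g ` T = g ` (S \<inter> T)" using g(2) by (simp add: image_Int)
      also have "\<dots> = {0}" using \<S>(3) that ST by (simp add: pairwise_def g.zero)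
      finally have "vec.dim (g ` S \<inter> g ` T) = 0" by simp
      moreover have "g ` S \<noteq> g ` T" using ST g(2) by (simp add: inj_image_eq_iff)
      ultimately show False using intersecting_familyD[OF F(2) that(3,4)] by linarith
    qed
    then show "card {S \<in> \<S>. g ` S \<in> F} \<le> 1"
      by (simp add: card_le_Suc0_iff_eq)
  qed
  finally have main: "(\<Sum>S\<in>\<S>. card {g \<in> GL. g ` S \<in> F}) \<le> card GL" by simp
  have each: "card {g \<in> GL. g ` S \<in> F} * card ?L = card F * card GL" if "S \<in> \<S>" for S
  proof -
    have "card {g \<in> GL. g ` S \<in> F} = (\<Sum>U\<in>F. card {g \<in> {g \<in> GL. g ` S \<in> F}. g ` S = U})"
      using sum.group[of "{g \<in> GL. g ` S \<in> F}" F "\<lambda>g. g ` S" "\<lambda>_. 1 :: nat"] by (simp add: image_subset_iff)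
    also have "\<dots> = (\<Sum>U\<in>F. N S U)"
      unfolding N_def by (intro sum.cong arg_cong[of _ _ card]) auto
    also have "\<dots> * card ?L = (\<Sum>U\<in>F. card GL)"
      unfolding sum_distrib_right using tot \<S>(1) F(1) that by (intro sum.cong) auto
    finally show ?thesis by simp
  qed
  have eq: "(\<Sum>S\<in>\<S>. card {g \<in> GL. g ` S \<in> F}) * card ?L = card \<S> * (card F * card GL)"
    unfolding sum_distrib_right by (simp add: each)
  have "card \<S> * (card F * card GL) \<le> card GL * card ?L"
    using mult_le_mono1[OF main, of "card ?L"] by (simp only: eq)
  moreover have "id \<in> GL" by (simp add: GL_def vec.linear_id)
  then have "card GL > 0" by (auto simp: card_gt_0_iff)
  moreover from calculation have "card GL * (card \<S> * card F) \<le> card GL * card ?L"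
    by (simp only: mult_ac)
  ultimately have "card \<S> * card F \<le> card ?L" by (simp only: mult_le_cancel1)
  then have "real (card \<S> * card F) \<le> real (card ?L)" by (simp only: of_nat_le_iff)
  also have "\<dots> = gauss CARD('a) (2 * m) m"
    using card_between[where j=m and 'a='a and 'n='n, OF vec.subspace_single_0 vec.subspace_UNIV subset_UNIV, unfolded vec_dim_card n]
    by simp
  finally have c: "(?q ^ m + 1) * real (card F) \<le> gauss CARD('a) (2 * m) m"
    unfolding \<S>(2) by (simp add: algebra_simps)
  have q: "CARD('a) \<ge> 2" by (rule card_field_ge_2)
  have qm: "?q ^ m > 1" using q_power_gt_1[OF q] m by simp
  \<comment> \<open>The quotient of \<open>gauss q (2 * m) m\<close> by the claimed bound is exactly
    \<open>q^m + 1\<close>, the size of the spread.\<close>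
  have "gauss CARD('a) (2 * m) m * (?q ^ m - 1) = gauss CARD('a) (2 * m - 1) (m - 1) * (?q ^ (2 * m) - 1)"
    using gauss_Suc_Suc[OF q, of "m - 1" "2 * m - 1"] m by (simp del: power_Suc add: Suc_diff_le)
  also have "?q ^ (2 * m) - 1 = (?q ^ m + 1) * (?q ^ m - 1)"
    unfolding mult_2 power_add by (simp add: algebra_simps)
  finally have "gauss CARD('a) (2 * m) m = gauss CARD('a) (2 * m - 1) (m - 1) * (?q ^ m + 1)"
    using qm by (simp only: mult.assoc[symmetric] mult_cancel_right) simp
  then have "(?q ^ m + 1) * real (card F) \<le> (?q ^ m + 1) * gauss CARD('a) (2 * m - 1) (m - 1)"
    using c by (simp only: mult.commute)
  moreover have "0 < ?q ^ m + 1" using qm by simp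
  ultimately show ?thesis by (simp only: mult_le_cancel_left_pos)
qed

section \<open>From shadow bounds to the Erdos-Ko-Rado theorem\<close>

lemma star_member_avoiding:
  fixes A U R :: "('a::field^'n::finite) set"
  assumes A: "vec.subspace A" and U: "vec.subspace U" "U \<subseteq> A"
    and R: "vec.subspace R" "vec.dim R = 1" "R \<subseteq> A" "\<not> R \<subseteq> U"
    and j: "1 \<le> j" "j + vec.dim U \<le> vec.dim A"
  obtains W where "W \<in> between R A j" "vec.dim (W \<inter> U) = 0"
proof -
  have d: "vec.dim (R \<inter> U) = 0"
  proof (rule ccontr)
    assume "vec.dim (R \<inter> U) \<noteq> 0"
    then have "vec.dim R \<le> vec.dim (R \<inter> U)" using R(2) by linarith
    then have "R \<inter> U = R" by (intro subspace_eqI vec.subspace_inter R(1) U(1) Int_lower1)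
    then show False using R by blast
  qed
  obtain W where "W \<in> between R A j" "W \<inter> U = R \<inter> U"
    using avoid_subspace[OF A R(1,3) U, of j] R j d by auto
  then show thesis using that d by simp
qed

lemma intersecting_family_subset: "intersecting_family F \<Longrightarrow> F' \<subseteq> F \<Longrightarrow> intersecting_family F'"
  unfolding intersecting_family_def pairwise_def by blast

text \<open>The lower bound on the dimension serves two superspaces of the same member, because
  \<open>intersecting_family\<close> speaks of distinct members only.\<close>

lemma intersecting_up_shadow:
  assumes F: "intersecting_family F" "\<And>S. S \<in> F \<Longrightarrow> vec.dim S \<ge> 1"
  shows "intersecting_family (up_shadow A j F)"
  unfolding intersecting_family_def
proof (rule pairwiseI)
  fix T T' assume "T \<in> up_shadow A j F" "T' \<in> up_shadow A j F"
  then obtain S S' where S: "S \<in> F" "S \<subseteq> T" "S' \<in> F" "S' \<subseteq> T'" by (auto simp: up_shadow_def)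
  have "vec.dim (S \<inter> S') > 0"
    using F(2)[OF S(1)] F(1) S by (cases "S = S'") (auto simp: intersecting_family_def pairwise_def)
  moreover have "vec.dim (S \<inter> S') \<le> vec.dim (T \<inter> T')" using S by (intro vec.dim_subset) auto
  ultimately show "vec.dim (T \<inter> T') > 0" by linarith
qed

text \<open>Reduces the theorem at level \<open>i\<close> to shadows of subfamilies of exactly star
  size. A larger family contains such a subfamily, which is a star by \<open>up_shadow_star\<close>;
  any further member avoids the centre and so meets some member of that star only in zero.\<close>

lemma ekr_from_shadow:
  fixes A :: "('a::{field,finite}^'n::finite) set"
  assumes A: "vec.subspace A" "vec.dim A = n" and i: "1 \<le> i" "i + 2 \<le> n" "2 * i \<le> n"
    and F: "F \<subseteq> between {0} A i" "intersecting_family F"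
    and sh: "\<And>F'. F' \<subseteq> F \<Longrightarrow> real (card F') = gauss CARD('a) (n - 1) (i - 1) \<Longrightarrow>
      real (card (up_shadow A (Suc i) F')) \<le> gauss CARD('a) (n - 1) i"
  shows "real (card F) \<le> gauss CARD('a) (n - 1) (i - 1)"
    and "real (card F) = gauss CARD('a) (n - 1) (i - 1) \<Longrightarrow>
      \<exists>R. vec.subspace R \<and> vec.dim R = 1 \<and> R \<subseteq> A \<and> F = between R A i"
proof -
  show "\<exists>R. vec.subspace R \<and> vec.dim R = 1 \<and> R \<subseteq> A \<and> F = between R A i"
    if "real (card F) = gauss CARD('a) (n - 1) (i - 1)"
    using up_shadow_star[OF A i(1,2) F(1) that sh[OF subset_refl that]] .
  show "real (card F) \<le> gauss CARD('a) (n - 1) (i - 1)"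
  proof (rule ccontr)
    assume big: "\<not> ?thesis"
    obtain R0 where R0: "R0 \<in> between {0} A 1"
      using between_nonempty[OF vec.subspace_single_0 A(1), of 1] A i by (auto simp: vec.subspace_0)
    note R0' = betweenD[OF R0]
    \<comment> \<open>The star at \<open>R0\<close> shows that the bound is a natural number, so
      that a subfamily of exactly this size can be chosen.\<close>
    have c: "real (card (between R0 A i)) = gauss CARD('a) (n - 1) (i - 1)"
      using card_between[OF R0'(1) A(1) R0'(3), of i] R0' A i by simp
    then have "card (between R0 A i) \<le> card F" using big by simp
    then obtain F' where F': "F' \<subseteq> F" "card F' = card (between R0 A i)"
      by (metis obtain_subset_with_card_n)
    have cF': "real (card F') = gauss CARD('a) (n - 1) (i - 1)" using F' c by simp
    have F'L: "F' \<subseteq> between {0} A i" using F' F by blast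
    obtain R where R: "vec.subspace R" "vec.dim R = 1" "R \<subseteq> A" "F' = between R A i"
      using up_shadow_star[OF A i(1,2) F'L cF' sh[OF F'(1) cF']] by blast
    have "F' \<noteq> F" using cF' big by auto
    then obtain U where U: "U \<in> F" "U \<notin> F'" using F' by blast
    have UL: "U \<in> between {0} A i" using U F by blast
    note U' = betweenD[OF UL]
    have "\<not> R \<subseteq> U" using U(2) U' R(4) by (simp add: between_def)
    then obtain W where W: "W \<in> between R A i" "vec.dim (W \<inter> U) = 0"
      using star_member_avoiding[OF A(1) U'(1,3) R(1,2,3), of i] i U' A by auto
    have "W \<in> F" "W \<noteq> U" using W R F' U by auto
    then show False using intersecting_familyD[OF F(2) _ U(1), of W] W(2) by simp
  qed
qed

text \<open>The shadow in the whole space is bounded by \<open>ekr_middle\<close> at level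
  \<open>m + 1\<close>. It contains the shadow inside \<open>A\<close> and, for each member,
  \<open>q^(m+1)\<close> covers that leave \<open>A\<close>. For a subfamily of star size, Pascal's
  rule leaves at most the next star size for the shadow inside \<open>A\<close>.\<close>

lemma ekr_hyperplane:
  fixes A :: "('a::{field,finite}^'n::finite) set"
  assumes n: "CARD('n) = 2 * m + 2" and m: "m \<ge> 1" and A: "vec.subspace A" "vec.dim A = 2 * m + 1"
    and F: "F \<subseteq> between {0} A m" "intersecting_family F"
  shows "real (card F) \<le> gauss CARD('a) (2 * m) (m - 1)"
    and "real (card F) = gauss CARD('a) (2 * m) (m - 1) \<Longrightarrow>
      \<exists>R. vec.subspace R \<and> vec.dim R = 1 \<and> R \<subseteq> A \<and> F = between R A m"
proof -
  let ?q = "real CARD('a)"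
  have q: "CARD('a) \<ge> 2" by (rule card_field_ge_2)
  have sh: "real (card (up_shadow A (Suc m) F')) \<le> gauss CARD('a) (2 * m + 1 - 1) m"
    if F': "F' \<subseteq> F" "real (card F') = gauss CARD('a) (2 * m + 1 - 1) (m - 1)" for F'
  proof -
    let ?W = "up_shadow UNIV (Suc m) F'" and ?V = "up_shadow A (Suc m) F'"
    let ?N = "\<lambda>S. between S UNIV (Suc m) - between S A (Suc m)"
    have FL: "S \<in> between {0} A m" if "S \<in> F'" for S using that F F' by blast
    have dim1: "vec.dim S \<ge> 1" if "S \<in> F'" for S using betweenD(4)[OF FL[OF that]] m by simp
    have "intersecting_family ?W"
      using intersecting_family_subset[OF F(2) F'(1)] dim1 by (rule intersecting_up_shadow)
    then have cW: "real (card ?W) \<le> gauss CARD('a) (2 * m + 1) m"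
      using ekr_middle[of "Suc m" ?W] n by (simp add: up_shadow_def)
    have dU: "vec.dim (UNIV :: ('a^'n) set) = Suc (vec.dim A)" unfolding vec_dim_card A(2) n by simp
    have Int: "S = T \<inter> A" "\<not> T \<subseteq> A" if S: "S \<in> F'" and T: "T \<in> ?N S" for S T
    proof -
      have T1: "T \<in> between S UNIV (Suc m)" using T by blast
      note T' = betweenD[OF T1] and S' = betweenD[OF FL[OF S]]
      show T2: "\<not> T \<subseteq> A" using T by (auto simp: between_def)
      have "vec.dim T = Suc (vec.dim (T \<inter> A))"
        using T'(4) hyperplane_Int(1)[OF vec.subspace_UNIV A(1) subset_UNIV dU T'(1) subset_UNIV T2] by simp
      then show "S = T \<inter> A"
        using S' T' by (intro subspace_eqI vec.subspace_inter A) auto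
    qed
    have "(\<Union>S\<in>F'. ?N S) \<subseteq> ?W"
      by (auto simp: up_shadow_def between_def vec.subspace_0)
    moreover have "?V \<subseteq> ?W" by (auto simp: up_shadow_def between_def)
    moreover have "?V \<inter> (\<Union>S\<in>F'. ?N S) = {}" using Int(2) by (auto simp: up_shadow_def between_def)
    ultimately have "card ?V + card (\<Union>S\<in>F'. ?N S) \<le> card ?W"
      by (subst card_Un_disjoint[symmetric]) (auto intro!: card_mono)
    moreover have "card (\<Union>S\<in>F'. ?N S) = (\<Sum>S\<in>F'. card (?N S))"
      using Int(1) by (intro card_UN_disjoint) (simp_all, blast)
    moreover have "card (?N S) = CARD('a) ^ Suc m" if S: "S \<in> F'" for S
    proof -
      note S' = betweenD[OF FL[OF S]]
      have "between S A (Suc m) \<subseteq> between S UNIV (Suc m)" by (intro between_mono) auto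
      then have "card (?N S) = card (between S UNIV (Suc m)) - card (between S A (Suc m))"
        by (simp add: card_Diff_subset)
      also have "\<dots> = qint CARD('a) (Suc (Suc m)) - qint CARD('a) (Suc m)"
        using card_points_above[OF S'(1) vec.subspace_UNIV subset_UNIV, unfolded S'(4) dU A(2)]
          card_points_above[OF S'(1) A(1) S'(3), unfolded S'(4) A(2)] by (simp add: Suc_diff_le)
      finally show ?thesis by simp
    qed
    ultimately have "card ?V + card F' * CARD('a) ^ Suc m \<le> card ?W" by simp
    then have "real (card ?V) + real (card F') * ?q ^ Suc m \<le> real (card ?W)"
      by (simp only: of_nat_add[symmetric] of_nat_mult[symmetric] of_nat_power[symmetric] of_nat_le_iff)
    also have "\<dots> \<le> gauss CARD('a) (2 * m + 1) m" by (rule cW)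
    also have "\<dots> = gauss CARD('a) (2 * m) m + ?q ^ Suc m * gauss CARD('a) (2 * m) (m - 1)"
      using gauss_pascal[OF q, of "m - 1" "2 * m"] m by (simp add: Suc_diff_le del: power_Suc)
    finally show ?thesis using F'(2) by (simp add: mult.commute)
  qed
  have i: "1 \<le> m" "m + 2 \<le> 2 * m + 1" "2 * m \<le> 2 * m + 1" using m by simp_all
  show "real (card F) \<le> gauss CARD('a) (2 * m) (m - 1)"
    using ekr_from_shadow(1)[OF A i F sh] by simp
  show "real (card F) = gauss CARD('a) (2 * m) (m - 1) \<Longrightarrow>
      \<exists>R. vec.subspace R \<and> vec.dim R = 1 \<and> R \<subseteq> A \<and> F = between R A m"
    using ekr_from_shadow(2)[OF A i F sh] by simp
qed

text \<open>\<open>ekr_hyperplane\<close> is transported along the embedding \<open>\<iota>\<close>,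
  which puts a zero at the extra index \<open>None\<close> of \<open>'n option\<close>.\<close>

lemma ekr_odd:
  fixes F :: "('a::{field,finite}^'n::finite) set set"
  assumes n: "CARD('n) = 2 * m + 1" and m: "m \<ge> 1"
    and F: "F \<subseteq> between {0} UNIV m" "intersecting_family F"
  shows "real (card F) \<le> gauss CARD('a) (2 * m) (m - 1)"
    and "real (card F) = gauss CARD('a) (2 * m) (m - 1) \<Longrightarrow>
      \<exists>R. vec.subspace R \<and> vec.dim R = 1 \<and> F = between R UNIV m"
proof -
  define \<iota> :: "'a^'n \<Rightarrow> 'a^'n option" where "\<iota> v = (\<chi> i. case i of None \<Rightarrow> 0 | Some j \<Rightarrow> vec_nth v j)" for v
  have lin: "Vector_Spaces.linear (*s) (*s) \<iota>"
    by unfold_locales (auto simp: \<iota>_def vec_eq_iff split: option.splits)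
  interpret \<iota>: Vector_Spaces.linear "(*s)" "(*s)" \<iota> by (rule lin)
  have inj: "inj \<iota>"
  proof (rule injI)
    fix v w assume "\<iota> v = \<iota> w"
    then have "vec_nth (\<iota> v) (Some j) = vec_nth (\<iota> w) (Some j)" for j by simp
    then show "v = w" by (simp add: \<iota>_def vec_eq_iff)
  qed
  have dim: "vec.dim (\<iota> ` U) = vec.dim U" for U
    using lin inj by (intro vec.dim_image_eq) (auto intro: inj_on_subset)
  have n': "CARD('n option) = 2 * m + 2" using n by simp
  have A: "vec.subspace (range \<iota>)" "vec.dim (range \<iota>) = 2 * m + 1"
    using \<iota>.subspace_image[OF vec.subspace_UNIV] dim[of UNIV] n by (simp_all only: vec_dim_card)
  have img: "\<iota> ` U \<in> between {0} (range \<iota>) m" if "U \<in> between {0} UNIV m" for U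
    using betweenD[OF that] \<iota>.subspace_image[of U] dim[of U]
    by (intro betweenI) (auto simp: vec.subspace_0)
  have FL: "image \<iota> ` F \<subseteq> between {0} (range \<iota>) m" using img F(1) by blast
  have int: "intersecting_family (image \<iota> ` F)"
    unfolding intersecting_family_def
  proof (rule pairwiseI)
    fix Z Y assume "Z \<in> image \<iota> ` F" "Y \<in> image \<iota> ` F" "Z \<noteq> Y"
    then obtain V W where VW: "V \<in> F" "W \<in> F" "Z = \<iota> ` V" "Y = \<iota> ` W" "V \<noteq> W" by blast
    have "Z \<inter> Y = \<iota> ` (V \<inter> W)" using inj VW by (simp add: image_Int)
    then have "vec.dim (Z \<inter> Y) = vec.dim (V \<inter> W)" by (simp only: dim)
    then show "vec.dim (Z \<inter> Y) > 0" using intersecting_familyD[OF F(2) VW(1,2,5)] by (simp only:)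
  qed
  have inj': "inj (image \<iota>)" by (rule injI) (simp add: inj_image_eq_iff[OF inj])
  have c: "card (image \<iota> ` F) = card F" using inj' by (simp add: card_image inj_on_subset)
  show "real (card F) \<le> gauss CARD('a) (2 * m) (m - 1)"
    using ekr_hyperplane(1)[OF n' m A FL int] c by simp
  assume "real (card F) = gauss CARD('a) (2 * m) (m - 1)"
  then obtain R where R: "vec.subspace R" "vec.dim R = 1" "R \<subseteq> range \<iota>"
      "image \<iota> ` F = between R (range \<iota>) m"
    using ekr_hyperplane(2)[OF n' m A FL int] c by auto
  define R' where "R' = \<iota> -` R"
  have iR: "\<iota> ` R' = R" using R(3) by (auto simp: R'_def)
  have sR: "vec.subspace R'" unfolding R'_def using R(1) by (rule \<iota>.subspace_vimage)
  have dR: "vec.dim R' = 1" using dim[of R'] iR R(2) by simp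
  have "V \<in> F \<longleftrightarrow> V \<in> between R' UNIV m" for V
  proof
    assume V: "V \<in> F"
    then have V1: "V \<in> between {0} UNIV m" using F(1) by blast
    have "\<iota> ` V \<in> between R (range \<iota>) m" using V R(4) by blast
    then have "\<iota> ` R' \<subseteq> \<iota> ` V" unfolding iR by (rule betweenD)
    then have "R' \<subseteq> V" using inj by (simp add: inj_image_subset_iff)
    then show "V \<in> between R' UNIV m" using betweenD[OF V1] by (intro betweenI)
  next
    assume "V \<in> between R' UNIV m"
    note V = betweenD[OF this]
    have "\<iota> ` R' \<subseteq> \<iota> ` V" using V(2) by (rule image_mono)
    then have "\<iota> ` V \<in> between R (range \<iota>) m"
      using V \<iota>.subspace_image[OF V(1)] dim[of V] unfolding iR by (intro betweenI) auto
    then have "\<iota> ` V \<in> image \<iota> ` F" using R(4) by simp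
    then show "V \<in> F" using inj' by (simp add: inj_image_mem_iff)
  qed
  then have "F = between R' UNIV m" by blast
  then show "\<exists>R. vec.subspace R \<and> vec.dim R = 1 \<and> F = between R UNIV m" using sR dR by blast
qed

text \<open>Downward induction from level \<open>n div 2\<close>: shadows of subfamilies are
  intersecting families one level higher, so the induction hypothesis is what
  \<open>ekr_from_shadow\<close> asks for. Uniqueness is restricted to levels below
  \<open>n/2\<close>, since for \<open>n = 2 * m\<close> with \<open>m \<ge> 2\<close> the
  \<open>m\<close>-dimensional subspaces of a hyperplane also attain the bound.\<close>

lemma ekr_vector_spaces:
  fixes F :: "('a::{field,finite}^'n::finite) set set"
  assumes i: "1 \<le> i" "2 * i \<le> CARD('n)"
    and F: "F \<subseteq> between {0} UNIV i" "intersecting_family F"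
  shows "real (card F) \<le> gauss CARD('a) (CARD('n) - 1) (i - 1) \<and>
    (2 * i < CARD('n) \<longrightarrow> real (card F) = gauss CARD('a) (CARD('n) - 1) (i - 1) \<longrightarrow>
      (\<exists>R. vec.subspace R \<and> vec.dim R = 1 \<and> F = between R UNIV i))"
proof -
  let ?n = "CARD('n)"
  have "i \<le> ?n div 2" using i by simp
  then show ?thesis
    using i F
  proof (induction i arbitrary: F rule: inc_induct)
    case base
    show ?case
    proof (cases "even ?n")
      case True
      then have n: "CARD('n) = 2 * (?n div 2)" by simp
      show ?thesis using ekr_middle[OF n base(1) base(3,4)] n by (simp del: One_nat_def)
    next
      case False
      then have n: "CARD('n) = 2 * (?n div 2) + 1" by simp
      have "2 * (?n div 2) = ?n - 1" using n by simp
      then show ?thesis using ekr_odd[OF n base(1) base(3,4)] by simp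
    qed
  next
    case (step i)
    have n: "vec.dim (UNIV :: ('a^'n) set) = ?n" by (rule vec_dim_card)
    have i2: "i + 2 \<le> ?n" using step.hyps step.prems by simp
    have sh: "real (card (up_shadow UNIV (Suc i) F')) \<le> gauss CARD('a) (?n - 1) i" if F': "F' \<subseteq> F" for F'
    proof -
      have "intersecting_family (up_shadow UNIV (Suc i) F')"
      proof (rule intersecting_up_shadow)
        show "intersecting_family F'" using step.prems(4) F' by (rule intersecting_family_subset)
        show "vec.dim S \<ge> 1" if "S \<in> F'" for S
          using that F' step.prems(1,3) betweenD(4)[of S "{0}" UNIV i] by auto
      qed
      moreover have "up_shadow UNIV (Suc i) F' \<subseteq> between {0} UNIV (Suc i)" by (auto simp: up_shadow_def)
      ultimately show ?thesis using step.IH[of "up_shadow UNIV (Suc i) F'"] step.hyps by simp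
    qed
    show ?case
      using ekr_from_shadow[OF vec.subspace_UNIV n step.prems(1) i2 step.prems(2,3,4) sh] by auto
  qed
qed

section \<open>Intersecting Sperner families\<close>

lemma card_star:
  fixes R :: "('a::{field,finite}^'n::finite) set"
  assumes "vec.subspace R" "vec.dim R = 1" "1 \<le> i" "i \<le> CARD('n)"
  shows "real (card (between R UNIV i)) = gauss CARD('a) (CARD('n) - 1) (i - 1)"
  using card_between[OF assms(1) vec.subspace_UNIV subset_UNIV, of i] assms(2-4) unfolding vec_dim_card by simp

lemma gauss_star_less_Suc:
  assumes q: "q \<ge> 2" and i: "1 \<le> i" "2 * i < n"
  shows "gauss q (n - 1) (i - 1) < gauss q (n - 1) i"
proof -
  have p: "real q ^ i - 1 > 0" using q_power_gt_1[OF q, of i] i by simp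
  have "real q ^ i < real q ^ (n - i)" using q i by (intro power_strict_increasing) auto
  moreover have "gauss q (n - 1) (i - 1) > 0" using i by (intro gauss_pos[OF q]) auto
  ultimately have "gauss q (n - 1) (i - 1) * (real q ^ i - 1) < gauss q (n - 1) (i - 1) * (real q ^ (n - i) - 1)"
    by simp
  also have "\<dots> = gauss q (n - 1) i * (real q ^ i - 1)" using gauss_star_Suc[OF q, of i n] i by simp
  finally show ?thesis using p by (simp only: mult_less_cancel_right_pos)
qed

lemma gauss_star_less:
  assumes q: "q \<ge> 2" and ij: "1 \<le> i" "i < j" "2 * j \<le> n"
  shows "gauss q (n - 1) (i - 1) < gauss q (n - 1) (j - 1)"
proof -
  have "Suc i \<le> j" using ij by simp
  then show ?thesis
    using ij(3)
  proof (induction j rule: dec_induct)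
    case base
    then show ?case using gauss_star_less_Suc[OF q ij(1), of n] by simp
  next
    case (step j)
    then show ?case using gauss_star_less_Suc[OF q, of j n] by simp
  qed
qed

text \<open>Passing to the shadow does not lower the size relative to a star, and the antichain
  property keeps the shadow disjoint from the members of \<open>F\<close> on the next level, so
  weights accumulate from level to level. The Erdos-Ko-Rado bound licenses the shadow inequality at
  every level and gives the final estimate at the top.\<close>

lemma lym_intersecting_antichain:
  fixes F :: "('a::{field,finite}^'n::finite) set set"
  assumes F: "intersecting_family F" "\<And>V. V \<in> F \<Longrightarrow> vec.subspace V"
    "\<And>V. V \<in> F \<Longrightarrow> 1 \<le> vec.dim V" "\<And>V. V \<in> F \<Longrightarrow> 2 * vec.dim V \<le> CARD('n)"
    and anti: "\<And>V W. V \<in> F \<Longrightarrow> W \<in> F \<Longrightarrow> V \<subseteq> W \<Longrightarrow> V = W"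
  shows "(\<Sum>V\<in>F. 1 / gauss CARD('a) (CARD('n) - 1) (vec.dim V - 1)) \<le> 1"
proof -
  let ?n = "CARD('n)" and ?q = "real CARD('a)"
  define c where "c i = gauss CARD('a) (?n - 1) (i - 1)" for i
  \<comment> \<open>\<open>F\<close> has members of several dimensions, so \<open>?U i\<close> is
    level \<open>i\<close> of the whole up-set generated by \<open>F\<close>.\<close>
  let ?U = "\<lambda>i. up_shadow UNIV i F" and ?L = "\<lambda>i. {V \<in> F. vec.dim V = i}"
  have q: "CARD('a) \<ge> 2" by (rule card_field_ge_2)
  have cpos: "c i > 0" if "1 \<le> i" "2 * i \<le> ?n" for i
    unfolding c_def using that by (intro gauss_pos[OF q]) auto
  have UL: "?U i \<subseteq> between {0} UNIV i" for i by (auto simp: up_shadow_def)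
  have LU: "?L i \<subseteq> ?U i" for i using F(2) by (auto simp: up_shadow_def between_def vec.subspace_0)
  have Uc: "real (card (?U i)) \<le> c i" if "1 \<le> i" "2 * i \<le> ?n" for i
    using ekr_vector_spaces[OF that UL intersecting_up_shadow[OF F(1,3)]] by (simp add: c_def)
  have single: "(\<Sum>V\<in>?L i. 1 / c (vec.dim V)) = real (card (?L i)) / c i" for i by simp
  have claim: "(\<Sum>V\<in>{V \<in> F. vec.dim V \<le> i}. 1 / c (vec.dim V)) \<le> real (card (?U i)) / c i"
    if "1 \<le> i" "2 * i \<le> ?n" for i
    using that
  proof (induction i rule: dec_induct)
    case base
    have "{V \<in> F. vec.dim V \<le> 1} = ?L 1" using F(3) by (force simp: le_antisym)
    then have "(\<Sum>V\<in>{V \<in> F. vec.dim V \<le> 1}. 1 / c (vec.dim V)) = real (card (?L 1)) / c 1"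
      by (simp only: single)
    also have "\<dots> \<le> real (card (?U 1)) / c 1"
      using LU[of 1] cpos[of 1] base by (intro divide_right_mono) (auto intro: card_mono)
    finally show ?case .
  next
    case (step i)
    have i: "1 \<le> i" "2 * i \<le> ?n" "i + 2 \<le> ?n" using step by simp_all
    let ?V = "up_shadow UNIV (Suc i) (?U i)"
    have ci: "c i > 0" "c (Suc i) > 0" using cpos i step.prems by simp_all
    have qi: "?q ^ i - 1 > 0" using q_power_gt_1[OF q, of i] i by simp
    have "real (card (?U i)) * (?q ^ (?n - i) - 1) \<le> real (card ?V) * (?q ^ i - 1)"
      using up_shadow_bound[OF vec.subspace_UNIV vec_dim_card i(1,3) UL] Uc[OF i(1,2)] by (simp add: c_def)
    then have "real (card (?U i)) * (?q ^ (?n - i) - 1) * c i \<le> real (card ?V) * (?q ^ i - 1) * c i"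
      using ci by (intro mult_right_mono) auto
    have e: "c (Suc i) * (?q ^ i - 1) = c i * (?q ^ (?n - i) - 1)"
      using gauss_star_Suc[OF q, of i ?n] i by (simp add: c_def)
    have "(?q ^ i - 1) * (real (card (?U i)) * c (Suc i)) = real (card (?U i)) * (c (Suc i) * (?q ^ i - 1))"
      by (simp only: mult_ac)
    also have "\<dots> = real (card (?U i)) * (?q ^ (?n - i) - 1) * c i"
      unfolding e by (simp only: mult_ac)
    also have "\<dots> \<le> real (card ?V) * (?q ^ i - 1) * c i" by fact
    also have "\<dots> = (?q ^ i - 1) * (real (card ?V) * c i)" by (simp only: mult_ac)
    finally have "(?q ^ i - 1) * (real (card (?U i)) * c (Suc i)) \<le> (?q ^ i - 1) * (real (card ?V) * c i)" .
    then have "real (card (?U i)) * c (Suc i) \<le> real (card ?V) * c i"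
      using qi by (simp only: mult_le_cancel_left_pos)
    then have le: "real (card (?U i)) / c i \<le> real (card ?V) / c (Suc i)"
      using ci by (simp add: field_simps)
    have "?V \<inter> ?L (Suc i) = {}"
    proof (rule ccontr)
      assume "?V \<inter> ?L (Suc i) \<noteq> {}"
      then obtain W where W: "W \<in> ?V" "W \<in> F" "vec.dim W = Suc i" by blast
      then obtain S V where SV: "S \<in> ?U i" "S \<subseteq> W" "V \<in> F" "V \<subseteq> S" by (auto simp: up_shadow_def)
      then have "V = W" using anti W by blast
      then have "S = W" using SV by blast
      then show False using SV(1) UL[of i] W(3) betweenD(4)[of S "{0}" UNIV i] by auto
    qed
    moreover have "?V \<subseteq> ?U (Suc i)" by (auto simp: up_shadow_def)
    ultimately have "card ?V + card (?L (Suc i)) \<le> card (?U (Suc i))"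
      using LU[of "Suc i"] by (subst card_Un_disjoint[symmetric]) (auto intro!: card_mono)
    then have c1: "real (card ?V) + real (card (?L (Suc i))) \<le> real (card (?U (Suc i)))" by linarith
    have sp: "{V \<in> F. vec.dim V \<le> Suc i} = {V \<in> F. vec.dim V \<le> i} \<union> ?L (Suc i)" by auto
    have "(\<Sum>V\<in>{V \<in> F. vec.dim V \<le> Suc i}. 1 / c (vec.dim V))
      = (\<Sum>V\<in>{V \<in> F. vec.dim V \<le> i}. 1 / c (vec.dim V)) + (\<Sum>V\<in>?L (Suc i). 1 / c (vec.dim V))"
      unfolding sp by (rule sum.union_disjoint) auto
    also have "\<dots> \<le> real (card ?V) / c (Suc i) + real (card (?L (Suc i))) / c (Suc i)"
      unfolding single using step.IH[OF i(2)] le by simp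
    also have "\<dots> \<le> real (card (?U (Suc i))) / c (Suc i)"
      using c1 ci by (simp add: divide_right_mono flip: add_divide_distrib)
    finally show ?case .
  qed
  show ?thesis
  proof (cases "F = {}")
    case True
    then show ?thesis by simp
  next
    case False
    then obtain V where "V \<in> F" by blast
    then have m: "1 \<le> ?n div 2" "2 * (?n div 2) \<le> ?n" using F(3,4)[of V] by auto
    have "{V \<in> F. vec.dim V \<le> ?n div 2} = F" using F(4) by fastforce
    then have "(\<Sum>V\<in>F. 1 / c (vec.dim V)) \<le> real (card (?U (?n div 2))) / c (?n div 2)"
      using claim[OF m] by simp
    also have "\<dots> \<le> 1" using Uc[OF m] cpos[OF m] by simp
    finally show ?thesis by (simp add: c_def)
  qed
qed

text \<open>A nonempty chain of non-minimal members can be prolonged by a member strictly below its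
  least element.\<close>

lemma Sperner_family_remove_minimal:
  assumes "Sperner_family (Suc k) \<V>"
  shows "Sperner_family k {V \<in> \<V>. \<exists>W\<in>\<V>. W \<subset> V}"
  unfolding Sperner_family_def
proof (intro allI impI)
  fix C assume C: "subset.chain {V \<in> \<V>. \<exists>W\<in>\<V>. W \<subset> V} C"
  then have C\<V>: "subset.chain \<V> C" by (auto simp: subset_chain_def)
  then have fin: "finite C" using assms by (simp add: Sperner_family_def)
  show "finite C \<and> card C \<le> k"
  proof (cases "C = {}")
    case False
    then obtain Z where Z: "Z \<in> C" "\<And>Y. Y \<in> C \<Longrightarrow> Y \<subseteq> Z \<Longrightarrow> Z = Y"
      using finite_has_minimal[OF fin] by metis
    have least: "Z \<subseteq> Y" if "Y \<in> C" for Y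
    proof -
      have "Z \<subseteq> Y \<or> Y \<subseteq> Z" using Z(1) that C\<V> unfolding subset_chain_def by blast
      then show ?thesis using Z(2)[OF that] by blast
    qed
    obtain W where W: "W \<in> \<V>" "W \<subset> Z" using C Z(1) unfolding subset_chain_def by blast
    have "subset.chain \<V> (insert W C)"
      using C\<V> W least by (auto simp: subset_chain_def) 
    then have "card (insert W C) \<le> Suc k" using assms unfolding Sperner_family_def by blast
    moreover have "W \<notin> C" using least W by blast
    ultimately show ?thesis using fin by simp
  qed simp
qed

lemma lym_intersecting_Sperner:
  fixes \<V> :: "('a::{field,finite}^'n::finite) set set"
  assumes "intersecting_family \<V>" "\<And>V. V \<in> \<V> \<Longrightarrow> vec.subspace V"
    "\<And>V. V \<in> \<V> \<Longrightarrow> 1 \<le> vec.dim V" "\<And>V. V \<in> \<V> \<Longrightarrow> 2 * vec.dim V \<le> CARD('n)"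
    and "Sperner_family k \<V>"
  shows "(\<Sum>V\<in>\<V>. 1 / gauss CARD('a) (CARD('n) - 1) (vec.dim V - 1)) \<le> real k"
  using assms
proof (induction k arbitrary: \<V>)
  case 0
  have "\<V> = {}"
  proof (rule ccontr)
    assume "\<V> \<noteq> {}"
    then obtain V where "V \<in> \<V>" by blast
    then have "subset.chain \<V> {V}" by (simp add: subset_chain_def)
    then show False using 0(5) unfolding Sperner_family_def by fastforce
  qed
  then show ?case by simp
next
  case (Suc k)
  let ?R = "{V \<in> \<V>. \<exists>W\<in>\<V>. W \<subset> V}" and ?M = "{V \<in> \<V>. \<not> (\<exists>W\<in>\<V>. W \<subset> V)}"
  let ?w = "\<lambda>V :: ('a^'n) set. 1 / gauss CARD('a) (CARD('n) - 1) (vec.dim V - 1)"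
  have "(\<Sum>V\<in>?R. ?w V) \<le> real k"
    using Suc.prems(2-4) intersecting_family_subset[OF Suc.prems(1), of ?R] Sperner_family_remove_minimal[OF Suc.prems(5)]
    by (intro Suc.IH) auto
  moreover have "(\<Sum>V\<in>?M. ?w V) \<le> 1"
    using Suc.prems(2-4) intersecting_family_subset[OF Suc.prems(1), of ?M]
    by (intro lym_intersecting_antichain) auto
  moreover have "(\<Sum>V\<in>\<V>. ?w V) = (\<Sum>V\<in>?R. ?w V) + (\<Sum>V\<in>?M. ?w V)"
    by (subst sum.union_disjoint[symmetric]) (auto intro!: sum.cong)
  ultimately show ?case by simp
qed

text \<open>In the application \<open>T\<close> is the set of the top \<open>k\<close> levels, \<open>L\<close> the set of the levels below them,
  and \<open>d = c\<^sub>m\<^sub>-\<^sub>k\<close> (or \<open>0\<close> if there are none).\<close>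

lemma weighted_sum_bound:
  fixes c x :: "'b \<Rightarrow> real" and d :: real
  assumes fin: "finite T" "finite L" and d: "d \<ge> 0"
    and L: "\<And>i. i \<in> L \<Longrightarrow> 0 \<le> x i \<and> c i \<le> d" and T: "\<And>i. i \<in> T \<Longrightarrow> x i \<le> 1 \<and> d < c i"
    and s: "(\<Sum>i\<in>T. x i) + (\<Sum>i\<in>L. x i) \<le> real (card T)"
  shows "(\<Sum>i\<in>T. c i * x i) + (\<Sum>i\<in>L. c i * x i) \<le> (\<Sum>i\<in>T. c i)" (is "?A + ?B \<le> ?C")
    and "(\<Sum>i\<in>T. c i * x i) + (\<Sum>i\<in>L. c i * x i) = (\<Sum>i\<in>T. c i) \<longleftrightarrow> (\<forall>i\<in>T. x i = 1)"
proof -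
  have "?B \<le> (\<Sum>i\<in>L. d * x i)" using L by (intro sum_mono mult_right_mono) auto
  then have B: "?B \<le> d * (\<Sum>i\<in>L. x i)" by (simp add: sum_distrib_left)
  have "d * ((\<Sum>i\<in>T. x i) + (\<Sum>i\<in>L. x i)) \<le> d * real (card T)" using s d by (rule mult_left_mono)
  then have e: "d * (\<Sum>i\<in>L. x i) \<le> d * real (card T) - d * (\<Sum>i\<in>T. x i)"
    by (simp add: distrib_left)
  \<comment> \<open>The slack \<open>?C - ?A - ?B\<close> is at least this sum of nonnegative terms,
    so equality makes every term vanish; since \<open>d < c i\<close> on \<open>T\<close>, this
    forces \<open>x i = 1\<close>.\<close>
  have D: "(\<Sum>i\<in>T. (c i - d) * (1 - x i)) = ?C - ?A - (d * real (card T) - d * (\<Sum>i\<in>T. x i))"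
    by (simp add: algebra_simps sum.distrib sum_subtractf sum_distrib_left)
  have nn: "0 \<le> (c i - d) * (1 - x i)" if "i \<in> T" for i using T[OF that] by simp
  then have D0: "0 \<le> (\<Sum>i\<in>T. (c i - d) * (1 - x i))" by (rule sum_nonneg)
  show "?A + ?B \<le> ?C" using B e D D0 by linarith
  show "?A + ?B = ?C \<longleftrightarrow> (\<forall>i\<in>T. x i = 1)"
  proof
    assume "?A + ?B = ?C"
    then have "(\<Sum>i\<in>T. (c i - d) * (1 - x i)) = 0" using B e D D0 by linarith
    then have "\<forall>i\<in>T. (c i - d) * (1 - x i) = 0"
      using nn fin by (subst (asm) sum_nonneg_eq_0_iff) auto
    then show "\<forall>i\<in>T. x i = 1"
      using T by force
  next
    \<comment> \<open>Once \<open>T\<close> exhausts the total \<open>card T\<close>, nothing is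
      left for \<open>L\<close>.\<close>
    assume one: "\<forall>i\<in>T. x i = 1"
    then have "(\<Sum>i\<in>L. x i) \<le> 0" using s by simp
    then have "(\<Sum>i\<in>L. x i) = 0" using L by (intro antisym sum_nonneg) auto
    then have "\<forall>i\<in>L. x i = 0" using L fin by (subst (asm) sum_nonneg_eq_0_iff) auto
    then show "?A + ?B = ?C" using one by simp
  qed
qed

section \<open>Extremal families and the characterisation of equality\<close>

lemma sum_gaussian_star_levels:
  "(\<Sum>j = int m - int k + 1..int m. gaussian_coefficient q (n - 1) (j - 1))
    = (\<Sum>i\<in>{i \<in> {1..m}. m < i + k}. gauss q (n - 1) (i - 1))"
proof -
  let ?T = "{i \<in> {1..m}. m < i + k}"
  have "(\<Sum>i\<in>?T. gauss q (n - 1) (i - 1)) = (\<Sum>i\<in>?T. gaussian_coefficient q (n - 1) (int i - 1))"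
    by (intro sum.cong) (auto simp: gauss_def of_nat_diff)
  also have "\<dots> = (\<Sum>j\<in>int ` ?T. gaussian_coefficient q (n - 1) (j - 1))"
    by (simp add: sum.reindex)
  also have "\<dots> = (\<Sum>j = int m - int k + 1..int m. gaussian_coefficient q (n - 1) (j - 1))"
  proof (rule sum.mono_neutral_left)
    show "int ` ?T \<subseteq> {int m - int k + 1..int m}" by auto
    \<comment> \<open>When \<open>k\<close> exceeds \<open>m\<close>, indices
      \<open>j \<le> 0\<close> occur; their lower index \<open>j - 1\<close> is negative, where the
      coefficient is zero by definition.\<close>
    show "\<forall>j\<in>{int m - int k + 1..int m} - int ` ?T. gaussian_coefficient q (n - 1) (j - 1) = 0"
    proof
      fix j assume j: "j \<in> {int m - int k + 1..int m} - int ` ?T"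
      have "\<not> 1 \<le> j"
      proof
        assume "1 \<le> j"
        then have "nat j \<in> ?T" "j = int (nat j)" using j by auto
        then show False using j by blast
      qed
      then show "gaussian_coefficient q (n - 1) (j - 1) = 0" by (simp add: gaussian_coefficient_def)
    qed
  qed simp
  finally show ?thesis ..
qed

text \<open>The bound on the dimensions leaves room for a member of the star that meets a given
  \<open>U\<close> avoiding the centre only in zero.\<close>

lemma star_propagates:
  fixes \<V> :: "('a::{field,finite}^'n::finite) set set"
  assumes int: "intersecting_family \<V>"
    and R: "vec.subspace R" "vec.dim R = 1" and star: "between R UNIV i \<subseteq> \<V>" and i: "1 \<le> i"
    and U: "U \<in> \<V>" "vec.subspace U" "i + vec.dim U \<le> CARD('n)"
  shows "R \<subseteq> U"
proof (rule ccontr)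
  assume n: "\<not> R \<subseteq> U"
  have d: "i + vec.dim U \<le> vec.dim (UNIV :: ('a^'n) set)" using U(3) unfolding vec_dim_card .
  obtain W where W: "W \<in> between R UNIV i" "vec.dim (W \<inter> U) = 0"
    by (rule star_member_avoiding[OF vec.subspace_UNIV U(2) subset_UNIV R subset_UNIV n i d])
  have "W \<noteq> U" using betweenD(2)[OF W(1)] n by blast
  moreover have "W \<in> \<V>" using W(1) star by blast
  ultimately show False using intersecting_familyD[OF int _ U(1), of W] W(2) by linarith
qed

lemma zero_in_intersecting_family:
  assumes "intersecting_family \<V>" "{0} \<in> \<V>"
  shows "\<V> = {{0}}"
proof -
  have "V = {0}" if "V \<in> \<V>" for V
  proof (rule ccontr)
    assume "V \<noteq> {0}"
    then have "vec.dim (V \<inter> {0}) > 0" using intersecting_familyD[OF assms(1) that assms(2)] by simp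
    moreover have "vec.dim (V \<inter> {0}) = 0" by (subst vec.dim_eq_0) simp
    ultimately show False by linarith
  qed
  then show ?thesis using assms(2) by blast
qed

lemma line_exists:
  obtains R :: "('a::field^'n::finite) set" where "vec.subspace R" "vec.dim R = 1"
proof -
  have "vec.dim (UNIV :: ('a^'n) set) \<ge> 1" unfolding vec_dim_card by (simp add: Suc_le_eq)
  then have "vec.dim {0::'a^'n} \<le> 1" "1 \<le> vec.dim (UNIV :: ('a^'n) set)" by simp_all
  then obtain R where "R \<in> between {0::'a^'n} UNIV 1"
    using between_nonempty[OF vec.subspace_single_0 vec.subspace_UNIV subset_UNIV] by metis
  then show thesis using that betweenD by metis
qed

text \<open>Passes from integer levels to positive natural ones. For \<open>j \<le> 0\<close> both
  families are empty, because members of \<open>\<V>\<close> and subspaces through \<open>R\<close>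
  have positive dimension.\<close>

lemma star_levels_iff:
  fixes \<V> :: "('a::field^'n::finite) set set"
  assumes dim: "\<And>V. V \<in> \<V> \<Longrightarrow> 1 \<le> vec.dim V"
    and R: "vec.dim R = 1"
  shows "(\<forall>j\<in>{int m - int k + 1..int m}. dim_level \<V> j = subspaces_containing j R)
    \<longleftrightarrow> (\<forall>i\<in>{i \<in> {1..m}. m < i + k}. {V \<in> \<V>. vec.dim V = i} = between R UNIV i)"
proof -
  have lev: "dim_level \<V> (int i) = {V \<in> \<V>. vec.dim V = i}" for i by (simp add: dim_level_def)
  have con: "subspaces_containing (int i) R = between R UNIV i" for i
    by (auto simp: subspaces_containing_def between_def)
  show ?thesis
  proof
    assume L: "\<forall>j\<in>{int m - int k + 1..int m}. dim_level \<V> j = subspaces_containing j R"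
    show "\<forall>i\<in>{i \<in> {1..m}. m < i + k}. {V \<in> \<V>. vec.dim V = i} = between R UNIV i"
    proof
      fix i assume "i \<in> {i \<in> {1..m}. m < i + k}"
      then have "int i \<in> {int m - int k + 1..int m}" by auto
      then show "{V \<in> \<V>. vec.dim V = i} = between R UNIV i" using L lev con by metis
    qed
  next
    assume L: "\<forall>i\<in>{i \<in> {1..m}. m < i + k}. {V \<in> \<V>. vec.dim V = i} = between R UNIV i"
    show "\<forall>j\<in>{int m - int k + 1..int m}. dim_level \<V> j = subspaces_containing j R"
    proof
      fix j assume j: "j \<in> {int m - int k + 1..int m}"
      show "dim_level \<V> j = subspaces_containing j R"
      proof (cases "1 \<le> j")
        case True
        then have "nat j \<in> {i \<in> {1..m}. m < i + k}" "j = int (nat j)" using j by auto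
        then show ?thesis using L lev con by metis
      next
        case False
        have "dim_level \<V> j = {}" using dim False by (force simp: dim_level_def)
        moreover have "1 \<le> vec.dim V" if "R \<subseteq> V" for V using vec.dim_subset[OF that] R by simp
        then have "subspaces_containing j R = {}" using False by (force simp: subspaces_containing_def)
        ultimately show ?thesis by simp
      qed
    qed
  qed
qed

text \<open>One full level strictly below \<open>n/2\<close> is a star, and its centre then lies in
  the members of all other full levels. For \<open>m \<ge> 2\<close> such a level is
  \<open>m\<close> if \<open>n\<close> is odd and \<open>m - 1\<close> if \<open>n\<close> is even;
  the latter belongs to the top \<open>k\<close> levels because \<open>exc\<close> rules out
  \<open>k = 1\<close>. The cases \<open>m \<le> 1\<close> are treated directly.\<close>

lemma star_of_extremal:
  fixes \<V> :: "('a::{field,finite}^'n::finite) set set"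
  assumes k: "k \<ge> 1" and exc: "\<not> (k = 1 \<and> even CARD('n) \<and> CARD('n) \<ge> 4)"
    and sub: "\<And>V. V \<in> \<V> \<Longrightarrow> vec.subspace V" and int: "intersecting_family \<V>"
    and m: "m = CARD('n) div 2"
    and full: "\<And>i. i \<in> {i \<in> {1..m}. m < i + k} \<Longrightarrow>
      real (card {V \<in> \<V>. vec.dim V = i}) = gauss CARD('a) (CARD('n) - 1) (i - 1)"
  obtains R where "vec.subspace R" "vec.dim R = 1"
    "\<forall>i\<in>{i \<in> {1..m}. m < i + k}. {V \<in> \<V>. vec.dim V = i} = between R UNIV i"
proof -
  let ?n = "CARD('n)" and ?L = "\<lambda>i. {V \<in> \<V>. vec.dim V = i}" and ?T = "{i \<in> {1..m}. m < i + k}"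
  have LL: "?L i \<subseteq> between {0} UNIV i" for i using sub by (auto simp: between_def vec.subspace_0)
  note star_found = that
  have pivot: thesis if i0: "i0 \<in> ?T" and R: "vec.subspace R" "vec.dim R = 1" "?L i0 = between R UNIV i0" for i0 R
  proof (rule star_found[OF R(1,2)], intro ballI)
    fix j assume j: "j \<in> ?T"
    have "?L j \<subseteq> between R UNIV j"
    proof
      fix U assume U: "U \<in> ?L j"
      have "R \<subseteq> U"
        using U sub[of U] i0 j m by (intro star_propagates[OF int R(1,2), of i0]) (auto simp flip: R(3))
      then show "U \<in> between R UNIV j" using U sub by (auto simp: between_def)
    qed
    moreover have "real (card (between R UNIV j)) = real (card (?L j))"
      unfolding full[OF j] using j m by (intro card_star[OF R(1,2)]) auto
    ultimately show "?L j = between R UNIV j" by (intro card_subset_eq) simp_all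
  qed
  have pivot_ekr: thesis if i0: "i0 \<in> ?T" "2 * i0 < ?n" for i0
  proof -
    have "1 \<le> i0" "2 * i0 \<le> ?n" using i0 by auto
    then obtain R where "vec.subspace R" "vec.dim R = 1" "?L i0 = between R UNIV i0"
      using ekr_vector_spaces[OF _ _ LL intersecting_family_subset[OF int]] full[OF i0(1)] i0(2) by blast
    then show thesis using pivot i0(1) by blast
  qed
  consider "m = 0" | "m = 1" | "m \<ge> 2" "odd ?n" | "m \<ge> 2" "even ?n" by linarith
  then show thesis
  proof cases
    case 1
    obtain R :: "('a^'n) set" where "vec.subspace R" "vec.dim R = 1" by (rule line_exists)
    then show thesis using that 1 by auto
  next
    case 2
    have 1: "1 \<in> ?T" using 2 k by simp
    have "card (?L 1) = 1" using full[OF 1] by simp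
    then obtain R where R: "?L 1 = {R}" by (auto simp: card_1_singleton_iff)
    then have "R \<in> ?L 1" by simp
    then have R': "vec.subspace R" "vec.dim R = 1" using sub by auto
    have "R \<in> between R UNIV 1" using R' by (simp add: between_def)
    moreover have "U = R" if "U \<in> between R UNIV 1" for U
      using betweenD[OF that] R' by (intro subspace_eqI[symmetric]) auto
    ultimately have "between R UNIV 1 = {R}" by blast
    then show thesis using pivot[OF 1 R'] R by simp
  next
    case 3
    have "m \<in> ?T" using 3 k by simp
    moreover have "2 * m < ?n" using 3 m by presburger
    ultimately show thesis by (rule pivot_ekr)
  next
    case 4
    then have "k \<ge> 2" using k exc m by auto
    then have "m - 1 \<in> ?T" "2 * (m - 1) < ?n" using 4 m by auto
    then show thesis by (rule pivot_ekr)
  qed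
qed

text \<open>Two exceptions shape the statement. The family \<open>{{0}}\<close> is intersecting
  since it has no two distinct members; it exceeds the bound for \<open>n = 1\<close> and attains it
  without being a star for \<open>n = 2\<close> and \<open>n = 3\<close>. For \<open>k = 1\<close>
  and even \<open>n \<ge> 4\<close> the \<open>n/2\<close>-dimensional subspaces of a hyperplane
  attain the bound without forming a star, so only one direction of the equivalence is asserted
  there.\<close>

theorem theorem1p12:
  fixes \<V> :: "(('a::{field,finite}) ^ 'n::finite) set set"
    and q n k :: nat
  assumes "CARD('a) = q"
    and "CARD('n) = n"
    and "k \<ge> 1"
    and "\<forall>V\<in>\<V>. vec.subspace V"
    and "intersecting_family \<V>"
    and "Sperner_family k \<V>"
    and "\<forall>V\<in>\<V>. vec.dim V \<le> n div 2"
    and "n \<le> 3 \<longrightarrow> \<V> \<noteq> {{0}}"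
  shows "real (card \<V>) \<le> (\<Sum>j = int (n div 2) - int k + 1..int (n div 2).
             gaussian_coefficient q (n - 1) (j - 1))
    \<and> (\<not> (k = 1 \<and> even n \<and> n \<ge> 4) \<longrightarrow>
         (real (card \<V>) = (\<Sum>j = int (n div 2) - int k + 1..int (n div 2).
             gaussian_coefficient q (n - 1) (j - 1))
          \<longleftrightarrow> (\<exists>R. vec.subspace R \<and> vec.dim R = 1 \<and>
               (\<forall>j \<in> {int (n div 2) - int k + 1..int (n div 2)}.
                  dim_level \<V> j = subspaces_containing j R))))
    \<and> ((\<exists>R. vec.subspace R \<and> vec.dim R = 1 \<and>
             (\<forall>j \<in> {int (n div 2) - int k + 1..int (n div 2)}.
                dim_level \<V> j = subspaces_containing j R))
        \<longrightarrow> real (card \<V>) = (\<Sum>j = int (n div 2) - int k + 1..int (n div 2).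
             gaussian_coefficient q (n - 1) (j - 1)))"
proof -
  define m where "m = n div 2"
  define c where "c i = gauss q (n - 1) (i - 1)" for i
  let ?T = "{i \<in> {1..m}. m < i + k}" and ?J = "{int m - int k + 1..int m}"
  let ?L = "\<lambda>i. {V \<in> \<V>. vec.dim V = i}"
  let ?star = "\<exists>R. vec.subspace R \<and> vec.dim R = 1 \<and> (\<forall>j \<in> ?J. dim_level \<V> j = subspaces_containing j R)"
  have q: "q \<ge> 2" using card_field_ge_2[where 'a='a] assms(1) by simp
  have sub: "vec.subspace V" and dm: "vec.dim V \<le> m" if "V \<in> \<V>" for V
    using assms(4,7) that by (auto simp: m_def)
  have m2: "2 * m \<le> n" by (simp add: m_def)
  have cpos: "c i > 0" if "i \<in> {1..m}" for i
    unfolding c_def using that m2 by (intro gauss_pos[OF q]) auto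
  then have cnn: "0 \<le> c i" if "i \<in> {1..m}" for i using that by (meson less_imp_le)
  have cless: "c i < c j" if "1 \<le> i" "i < j" "j \<le> m" for i j
    unfolding c_def using that m2 by (intro gauss_star_less[OF q]) auto
  have rhs: "(\<Sum>j = int m - int k + 1..int m. gaussian_coefficient q (n - 1) (j - 1)) = (\<Sum>i\<in>?T. c i)"
    unfolding c_def by (rule sum_gaussian_star_levels)
  have goal: "real (card \<V>) \<le> (\<Sum>i\<in>?T. c i)
    \<and> (\<not> (k = 1 \<and> even n \<and> n \<ge> 4) \<longrightarrow> (real (card \<V>) = (\<Sum>i\<in>?T. c i) \<longleftrightarrow> ?star))
    \<and> (?star \<longrightarrow> real (card \<V>) = (\<Sum>i\<in>?T. c i))"
  proof (cases "{0} \<in> \<V>")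
    case True
    then have V0: "\<V> = {{0}}" by (rule zero_in_intersecting_family[OF assms(5)])
    then have m: "m \<ge> 2" using assms(8) by (auto simp: m_def)
    then have mT: "m \<in> ?T" using assms(3) by simp
    \<comment> \<open>Since \<open>c 1 = 1\<close> and \<open>m \<ge> 2\<close>, the bound strictly
      exceeds the single member \<open>{0}\<close>.\<close>
    have "1 < c m" using cless[of 1 m] m by (simp add: c_def)
    also have "\<dots> \<le> (\<Sum>i\<in>?T. c i)" using mT by (intro member_le_sum) (use cnn in auto)
    finally have big: "real (card \<V>) < (\<Sum>i\<in>?T. c i)" using V0 by simp
    have "\<not> ?star"
    proof
      assume ?star
      then obtain R where R: "vec.subspace R" "vec.dim R = 1" "dim_level \<V> (int m) = subspaces_containing (int m) R"
        using assms(3) by auto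
      have "real (card (between R UNIV m)) = c m"
        using card_star[OF R(1,2), of m] m m2 assms(1,2) by (simp add: c_def)
      then have "between R UNIV m \<noteq> {}" using cpos[of m] m by auto
      then obtain W where "W \<in> between R UNIV m" by blast
      then have "W \<in> dim_level \<V> (int m)" unfolding R(3) by (simp add: between_def subspaces_containing_def)
      then show False using V0 m by (auto simp: dim_level_def)
    qed
    then show ?thesis using big by simp
  next
    case False
    have d1: "1 \<le> vec.dim V" if V: "V \<in> \<V>" for V
    proof -
      have "V \<noteq> {0}" using V False by blast
      then have "\<not> V \<subseteq> {0}" using zero_subset_subspace[OF sub[OF V]] by blast
      then have "vec.dim V \<noteq> 0" by (simp only: vec.dim_eq_0 not_False_eq_True)
      then show ?thesis by linarith
    qed
    define x where "x i = real (card (?L i)) / c i" for i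
    have cx: "c i * x i = real (card (?L i))" if "i \<in> {1..m}" for i using cpos[OF that] by (simp add: x_def)
    have x1: "x i \<le> 1" if i: "i \<in> {1..m}" for i
    proof -
      have "?L i \<subseteq> between {0} UNIV i" using sub by (auto simp: between_def vec.subspace_0)
      then have "real (card (?L i)) \<le> c i"
        using ekr_vector_spaces[of i "?L i"] i m2 assms(1,2) intersecting_family_subset[OF assms(5), of "?L i"]
        by (auto simp: c_def)
      then show ?thesis using cpos[OF i] by (simp add: x_def)
    qed
    have x0: "0 \<le> x i" if "i \<in> {1..m}" for i using cpos[OF that] by (simp add: x_def)
    let ?Low = "{i \<in> {1..m}. i + k \<le> m}"
    have split: "(\<Sum>i\<in>?T. f i) + (\<Sum>i\<in>?Low. f i) = (\<Sum>i\<in>{1..m}. f i)" for f :: "nat \<Rightarrow> real"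
      by (subst sum.union_disjoint[symmetric]) (auto intro!: sum.cong)
    have group: "(\<Sum>i\<in>{1..m}. \<Sum>V\<in>?L i. h V) = (\<Sum>V\<in>\<V>. h V)" for h :: "('a^'n) set \<Rightarrow> real"
      using d1 dm by (intro sum.group) auto
    have "(\<Sum>i\<in>{1..m}. x i) = (\<Sum>i\<in>{1..m}. \<Sum>V\<in>?L i. 1 / c (vec.dim V))"
      by (intro sum.cong) (simp_all add: x_def)
    also have "\<dots> = (\<Sum>V\<in>\<V>. 1 / c (vec.dim V))" by (rule group)
    also have "\<dots> \<le> real k"
      using lym_intersecting_Sperner[OF assms(5) sub d1 _ assms(6)] dm m2 assms(1,2)
      by (fastforce simp: c_def)
    finally have xk: "(\<Sum>i\<in>{1..m}. x i) \<le> real k" .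
    have cardV: "real (card \<V>) = (\<Sum>i\<in>?T. c i * x i) + (\<Sum>i\<in>?Low. c i * x i)"
      unfolding split using group[of "\<lambda>_. 1"] cx by simp
    define d where "d = (if k < m then c (m - k) else 0)"
    have d0: "d \<ge> 0" using cpos[of "m - k"] assms(3) by (auto simp: d_def intro: less_imp_le)
    have low: "0 \<le> x i \<and> c i \<le> d" if i: "i \<in> ?Low" for i
    proof -
      have "k < m" "i \<le> m - k" "1 \<le> i" "i \<in> {1..m}" using i by auto
      then show ?thesis using cless[of i "m - k"] x0[of i] by (cases "i = m - k") (auto simp: d_def)
    qed
    have top: "x i \<le> 1 \<and> d < c i" if i: "i \<in> ?T" for i
    proof -
      have i': "i \<in> {1..m}" "m < i + k" using i by auto
      then show ?thesis using x1[of i] cpos[of i] cless[of "m - k" i] by (auto simp: d_def)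
    qed
    \<comment> \<open>For \<open>k < m\<close> there are exactly \<open>k\<close> top levels and
      this is the LYM type inequality. Otherwise no lower levels exist and
      \<open>x i \<le> 1\<close> suffices.\<close>
    have s: "(\<Sum>i\<in>?T. x i) + (\<Sum>i\<in>?Low. x i) \<le> real (card ?T)"
    proof (cases "k < m")
      case True
      have "?T = {m - k + 1..m}" using True by auto
      then have "card ?T = k" using True by simp
      then show ?thesis using xk unfolding split by simp
    next
      case False
      then have Low0: "?Low = {}" by auto
      show ?thesis unfolding Low0 using sum_bounded_above[of ?T x 1] x1 by simp
    qed
    have fin: "finite ?T" "finite ?Low" by simp_all
    note bound = weighted_sum_bound(1)[OF fin d0 low top s]
    note tight = weighted_sum_bound(2)[OF fin d0 low top s]
    have full: "(\<forall>i\<in>?T. x i = 1) \<longleftrightarrow> (\<forall>i\<in>?T. real (card (?L i)) = c i)"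
    proof (intro ball_cong refl)
      fix i assume "i \<in> ?T"
      then have "c i > 0" using cpos[of i] by simp
      then show "x i = 1 \<longleftrightarrow> real (card (?L i)) = c i" by (auto simp: x_def)
    qed
    have star: "?star \<longleftrightarrow> (\<exists>R. vec.subspace R \<and> vec.dim R = 1 \<and> (\<forall>i\<in>?T. ?L i = between R UNIV i))"
      using star_levels_iff[OF d1, where m=m and k=k] by blast
    have star_full: "\<forall>i\<in>?T. real (card (?L i)) = c i" if st: ?star
    proof
      fix i assume i: "i \<in> ?T"
      obtain R where R: "vec.subspace R" "vec.dim R = 1" "\<forall>i\<in>?T. ?L i = between R UNIV i"
        using st unfolding star by blast
      have "?L i = between R UNIV i" using R(3) i by blast
      then show "real (card (?L i)) = c i"
        using card_star[OF R(1,2), of i] i m2 assms(1,2) by (simp add: c_def)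
    qed
    have full_star: ?star if "\<not> (k = 1 \<and> even n \<and> n \<ge> 4)" "\<forall>i\<in>?T. real (card (?L i)) = c i"
    proof -
      have exc: "\<not> (k = 1 \<and> even CARD('n) \<and> CARD('n) \<ge> 4)" using that(1) assms(2) by simp
      have m': "m = CARD('n) div 2" using assms(2) by (simp add: m_def)
      have full': "real (card (?L i)) = gauss CARD('a) (CARD('n) - 1) (i - 1)" if "i \<in> ?T" for i
        using \<open>\<forall>i\<in>?T. real (card (?L i)) = c i\<close> that assms(1,2) by (auto simp: c_def)
      obtain R where "vec.subspace R" "vec.dim R = 1" "\<forall>i\<in>?T. ?L i = between R UNIV i"
        by (rule star_of_extremal[OF assms(3) exc sub assms(5) m' full'])
      then show ?thesis unfolding star by blast
    qed
    show ?thesis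
      using bound tight full star_full full_star unfolding cardV by blast
  qed
  show ?thesis
    using goal unfolding rhs[symmetric] unfolding m_def .
qed

end
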